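(* Let $d,s\in\mathbb N$, $2<q,\sigma<\infty$, $l>0$, and for $j=1,\dots,s$ let $r_j>0$, $\alpha_j:=r_j-l$, $1\le p_j\le\infty$, $1\le\theta_j\le\infty$. Put $\overline r_j=(r_j,\dots,r_j)\in\mathbb R^d$, $\overline l=(l,\dots,l)\in\mathbb R^d$. Suppose that: (a) $\alpha_1<\dots<\alpha_s$ and $\alpha_1-\frac1{p_1}>\dots>\alpha_s-\frac1{p_s}$; (b) there is $j$ with $p_j<q$ and there is $j$ with $p_j>2$; (c) $p_j\notin\{2,q\}$ for all $j$; (d) $\frac{\alpha_{i}-\alpha_{j}}{1/p_{i}-1/p_{j}}\ne\frac{\alpha_{i'}-\alpha_{j'}}{1/p_{i'}-1/p_{j'}}$ whenever $i>j$, $i'>j'$, $(i,j)\ne(i',j')$. Let $I:=\{j\in\{1,\dots,s\}:p_j>q\}\ne\varnothing$. For $i\in I$ and $j$ with $p_j<q$ define $\lambda_{i,j}$ by $\frac1q=\frac{1-\lambda_{i,j}}{p_i}+\frac{\lambda_{i,j}}{p_j}$, and let $(i_0,j_0)$ be the pair maximizing $(1-\lambda_{i,j})\alpha_i+\lambda_{i,j}\alpha_j$ over all $i\in I$ and $j$ with $p_j<q$. Suppose that $(1-\lambda_{i_0,j_0})\alpha_{i_0}+\lambda_{i_0,j_0}\alpha_{j_0}<0$. Then, for every $n\in\mathbb Z_+$, $$d_n\Bigl(\bigcap_{j=1}^sSB^{\overline r_j}_{p_j,\theta_j}(\mathbb T^d),\,B^{\overline l}_{q,\sigma}(\mathbb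 T^d)\Bigr)=\infty.$$
   Context: Notation: $\mathbb N=\{1,2,\dots\}$, $\mathbb Z_+=\{0,1,2,\dots\}$, $1/\infty:=0$. Under hypotheses (a)–(d) the maximizing pair $(i_0,j_0)$ is unique. Besov spaces. $\mathbb T^d=[0,2\pi]^d$ with the endpoints of each interval glued; $(\cdot,\cdot)$ is the standard inner product on $\mathbb R^d$; $f\in L_1(\mathbb T^d)$ has Fourier series $\sum_{\overline k\in\mathbb Z^d}c_{\overline k}(f)e^{i(\overline k,\cdot)}$. Fix an infinitely smooth $\eta_0:\mathbb R\to[0,1]$ equal to $1$ on $[-1,1]$ and to $0$ outside $[-3/2,3/2]$; for $k\in\mathbb N$ let $\eta_k(t)=\eta_0(2^{-k}t)-\eta_0(2^{-k+1}t)$. For $\overline m=(m_1,\dots,m_d)\in\mathbb Z_+^d$ let $\eta_{\overline m}(\overline\xi)=\prod_{j=1}^d\eta_{m_j}(\xi_j)$ and $\Delta_{\overline m}f=\sum_{\overline k\in\mathbb Z^d}\eta_{\overline m}(\overline k)c_{\overline k}(f)e^{i(\overline k,\cdot)}$. For $\overline r\in(0,\infty)^d$, $1\le p,\theta\le\infty$, $x\in L_p(\mathbb T^d)$ let $\|x\|_{B^{\overline r}_{p,\theta}(\mathbb T^d)}=\bigl\|\{2^{(\overline m,\overline r)}\|\Delta_{\overline m}x\|_{L_p(\mathbb T^d)}\}_{\overline m\in\mathbb Z_+^d}\bigr\|_{l_\theta}$; $B^{\overline r}_{p,\theta}(\mathbb T^d)$ is the normed space of $x\in L_p(\mathbb T^d)$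 with finite norm, and $SB^{\overline r}_{p,\theta}(\mathbb T^d)$ is its unit ball. Kolmogorov width: for a set $M$, a normed space $X$ and $n\in\mathbb Z_+$, $d_n(M,X)=\inf_{L}\sup_{x\in M}\inf_{y\in L}\|x-y\|_X$, where $L$ ranges over the linear subspaces of $X$ of dimension at most $n$; $\|z\|_X=+\infty$ if $z\notin X$. *)

theory Defs
  imports "HOL-Probability.Essential_Supremum" "HOL-Library.Function_Algebras"
begin

section \<open>Extended Lebesgue norms\<close>

text \<open>Power of an extended nonnegative number; only used with exponents \<open>a > 0\<close>.\<close>

definition enn_powr :: "ennreal \<Rightarrow> real \<Rightarrow> ennreal" where
  "enn_powr x a = (if x = \<infinity> then \<infinity> else ennreal (enn2real x powr a))"

text \<open>The reciprocal of an exponent in \<open>[1,\<infinity>]\<close> as a real number, with \<open>1/\<infinity> = 0\<close>.\<close>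

definition recip :: "ennreal \<Rightarrow> real" where
  "recip p = enn2real (1 / p)"

text \<open>The \<open>L\<^sub>p\<close> norm of a nonnegative function, for \<open>1 \<le> p \<le> \<infinity>\<close>; with counting measure it
  is the \<open>l\<^sub>p\<close> norm of a family of nonnegative numbers.\<close>

definition eLp_norm :: "ennreal \<Rightarrow> 'a measure \<Rightarrow> ('a \<Rightarrow> ennreal) \<Rightarrow> ennreal" where
  "eLp_norm p M f =
     (if p = \<infinity> then esssup M f
      else enn_powr (\<integral>\<^sup>+x. enn_powr (f x) (enn2real p) \<partial>M) (recip p))"

section \<open>Fourier series on the torus\<close>

text \<open>The torus is the cube \<open>[0,2\<pi>]\<^sup>d\<close> with (unnormalised) Lebesgue measure; gluing opposite
  faces changes it by a null set only. Elements of \<open>L\<^sub>p\<close> are represented by functions on the whole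
  space, whose values outside the cube play no role.\<close>

definition torus :: "(real ^ 'd) measure" where
  "torus = lebesgue_on (cbox 0 (\<chi> i. 2 * pi))"

definition Lp_torus :: "ennreal \<Rightarrow> (real ^ 'd \<Rightarrow> complex) set" where
  "Lp_torus p = {f \<in> borel_measurable torus. eLp_norm p torus (\<lambda>x. ennreal (cmod (f x))) < \<infinity>}"

text \<open>\<open>trig k x\<close> is \<open>exp (i (k, x))\<close>.\<close>

definition trig :: "int ^ 'd \<Rightarrow> real ^ 'd \<Rightarrow> complex" where
  "trig k x = cis ((\<chi> i. real_of_int (k $ i)) \<bullet> x)"

definition fourier_coeff :: "(real ^ 'd \<Rightarrow> complex) \<Rightarrow> int ^ 'd \<Rightarrow> complex" where
  "fourier_coeff f k =
     complex_of_real (1 / (2 * pi) ^ CARD('d)) * (LINT x|torus. f x * cnj (trig k x))"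

section \<open>Dyadic decomposition and Besov spaces of mixed smoothness\<close>

definition cutoff :: "(real \<Rightarrow> real) \<Rightarrow> bool" where
  "cutoff \<eta> \<longleftrightarrow>
     (\<forall>k t. ((deriv ^^ k) \<eta>) differentiable (at t)) \<and>
     (\<forall>t. 0 \<le> \<eta> t \<and> \<eta> t \<le> 1) \<and>
     (\<forall>t\<in>{-1..1}. \<eta> t = 1) \<and>
     (\<forall>t. t \<notin> {-3/2..3/2} \<longrightarrow> \<eta> t = 0)"

definition dyadic :: "(real \<Rightarrow> real) \<Rightarrow> nat \<Rightarrow> real \<Rightarrow> real" where
  "dyadic \<eta> k t = (if k = 0 then \<eta> t else \<eta> (t / 2 ^ k) - \<eta> (t / 2 ^ (k - 1)))"

definition dyadic_prod :: "(real \<Rightarrow> real) \<Rightarrow> nat ^ 'd \<Rightarrow> real ^ 'd \<Rightarrow> real" where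
  "dyadic_prod \<eta> m \<xi> = (\<Prod>j\<in>UNIV. dyadic \<eta> (m $ j) (\<xi> $ j))"

text \<open>For a cutoff \<open>\<eta>\<close> the sum below has finitely many nonzero terms.\<close>

definition dyadic_block ::
  "(real \<Rightarrow> real) \<Rightarrow> nat ^ 'd \<Rightarrow> (real ^ 'd \<Rightarrow> complex) \<Rightarrow> real ^ 'd \<Rightarrow> complex" where
  "dyadic_block \<eta> m f x =
     (\<Sum>\<^sub>\<infinity>k. complex_of_real (dyadic_prod \<eta> m (\<chi> i. real_of_int (k $ i)))
              * fourier_coeff f k * trig k x)"

definition besov_norm ::
  "(real \<Rightarrow> real) \<Rightarrow> real ^ 'd \<Rightarrow> ennreal \<Rightarrow> ennreal \<Rightarrow> (real ^ 'd \<Rightarrow> complex) \<Rightarrow> ennreal" where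
  "besov_norm \<eta> r p \<theta> f =
     eLp_norm \<theta> (count_space UNIV)
       (\<lambda>m. ennreal (2 powr ((\<chi> i. real (m $ i)) \<bullet> r))
            * eLp_norm p torus (\<lambda>x. ennreal (cmod (dyadic_block \<eta> m f x))))"

definition besov_space ::
  "(real \<Rightarrow> real) \<Rightarrow> real ^ 'd \<Rightarrow> ennreal \<Rightarrow> ennreal \<Rightarrow> (real ^ 'd \<Rightarrow> complex) set" where
  "besov_space \<eta> r p \<theta> = {f \<in> Lp_torus p. besov_norm \<eta> r p \<theta> f < \<infinity>}"

definition besov_ball ::
  "(real \<Rightarrow> real) \<Rightarrow> real ^ 'd \<Rightarrow> ennreal \<Rightarrow> ennreal \<Rightarrow> (real ^ 'd \<Rightarrow> complex) set" where
  "besov_ball \<eta> r p \<theta> = {f \<in> besov_space \<eta> r p \<theta>. besov_norm \<eta> r p \<theta> f \<le> 1}"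

section \<open>Kolmogorov widths\<close>

interpretation cfun: vector_space "\<lambda>(c::complex) (f::'a \<Rightarrow> complex) x. c * f x"
  by standard (simp_all add: fun_eq_iff algebra_simps)

text \<open>The width of \<open>M\<close> in the normed space of functions with carrier \<open>X\<close> and norm \<open>N\<close>, where
  functions at distance \<open>0\<close> are identified. The linear subspaces of dimension at most \<open>n\<close> are
  the spans of sets of at most \<open>n\<close> elements; working with representatives instead of classes does
  not change the infimum, since every such subspace of classes lifts to one of representatives.
  (\<open>cfun.dim\<close> is not used because it is \<open>0\<close> on infinite-dimensional subspaces.)\<close>

definition kolmogorov_width ::
  "('a \<Rightarrow> complex) set \<Rightarrow> ('a \<Rightarrow> complex) set \<Rightarrow> (('a \<Rightarrow> complex) \<Rightarrow> ennreal) \<Rightarrow> nat \<Rightarrow> ennreal" where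
  "kolmogorov_width M X N n =
     (INF L \<in> {L. L \<subseteq> X \<and> (\<exists>B. finite B \<and> card B \<le> n \<and> L = cfun.span B)}.
        SUP x\<in>M. INF y\<in>L. (if x - y \<in> X then N (x - y) else \<infinity>))"

end

theory Submission
  imports Defs
begin

text \<open>
  It suffices to find one function \<open>f\<close> in all the balls but outside \<open>B\<^sup>l\<^sub>q\<^sub>,\<^sub>\<sigma>\<close>, because the latter is
  closed under sums and contains the approximating subspaces. Take
  \<open>f = \<Sum>\<^sub>K c\<^sub>K g\<^sub>K\<close>, where \<open>g\<^sub>K\<close> depends on one coordinate only and is a squared Dirichlet kernel of
  order \<open>M \<approx> 2\<^sup>t\<^sup>K\<close>, \<open>0 < t < 1\<close>, modulated so that its spectrum lies in \<open>(3/4 \<cdot> 2\<^sup>K, 2\<^sup>K]\<close>. There the cutoff of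
  exactly one dyadic block is \<open>1\<close> and all others vanish, so the nonzero blocks of \<open>f\<close> are
  the \<open>c\<^sub>K g\<^sub>K\<close>. Since \<open>\<parallel>g\<^sub>K\<parallel>\<^sub>1 \<approx> M\<close>, \<open>\<parallel>g\<^sub>K\<parallel>\<^sub>2\<^sup>2 \<approx> M\<^sup>3\<close> (Parseval) and \<open>\<bar>g\<^sub>K\<bar> \<le> M\<^sup>2\<close>, interpolation gives
  \<open>\<parallel>g\<^sub>K\<parallel>\<^sub>p \<approx> M\<close> to the power \<open>2 - 1/p\<close>, from above for all \<open>p\<close> and from below for \<open>p = q > 2\<close>.
  Coefficients \<open>c\<^sub>K\<close> of geometric growth or decay with the required properties exist as soon as some \<open>t\<close>
  satisfies \<open>\<alpha>\<^sub>j < t (1/p\<^sub>j - 1/q)\<close> for all \<open>j\<close>. These are lower bounds on \<open>t\<close> for \<open>p\<^sub>j < q\<close> and upper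
  bounds for \<open>p\<^sub>j > q\<close>; a lower and an upper bound are compatible iff the corresponding
  interpolated smoothness is negative, and the monotonicity of \<open>\<alpha>\<^sub>j\<close> and \<open>\<alpha>\<^sub>j - 1/p\<^sub>j\<close> makes them
  compatible with \<open>0 < t < 1\<close>.
\<close>

section \<open>Trigonometric polynomials on the torus\<close>

text \<open>Fubini's theorem: \<open>lborel\<close> is the image of the product of one-dimensional
  Lebesgue measures under recombination of coordinates, so a product of functions of single
  coordinates integrates factor by factor.\<close>

lemma integral_lborel_prod:
  fixes f :: "'a::euclidean_space \<Rightarrow> real \<Rightarrow> complex"
  assumes "\<And>b. b \<in> Basis \<Longrightarrow> integrable lborel (f b)"
  shows "(LINT x|lborel. (\<Prod>b\<in>Basis. f b (x \<bullet> b))) = (\<Prod>b\<in>Basis. LINT t|lborel. f b t)"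
proof -
  interpret product_sigma_finite "\<lambda>b::'a. lborel :: real measure"
    by standard
  have [measurable]: "f b \<in> borel_measurable borel" if "b \<in> Basis" for b
    using assms[OF that] by (simp add: borel_measurable_integrable)
  have "(LINT x|lborel. (\<Prod>b\<in>Basis. f b (x \<bullet> b)))
      = (LINT g|Pi\<^sub>M Basis (\<lambda>b::'a. lborel). (\<Prod>b\<in>Basis. f b ((\<Sum>c\<in>Basis. g c *\<^sub>R c) \<bullet> b)))"
    by (subst lborel_eq, subst integral_distr) auto
  also have "\<dots> = (LINT g|Pi\<^sub>M Basis (\<lambda>b::'a. lborel). (\<Prod>b\<in>Basis. f b (g b)))"
    by (intro Bochner_Integration.integral_cong prod.cong refl) (simp add: inner_sum_left_Basis)
  also have "\<dots> = (\<Prod>b\<in>Basis. LINT t|lborel. f b t)"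
    using assms by (intro product_integral_prod) auto
  finally show ?thesis .
qed

lemma integral_torus_eq:
  fixes f :: "real ^ 'd \<Rightarrow> complex"
  assumes [measurable]: "f \<in> borel_measurable borel"
  shows "(LINT x|torus. f x) = (LINT x|lborel. indicator (cbox 0 (\<chi> i. 2 * pi)) x *\<^sub>R f x)"
proof -
  have "(LINT x|torus. f x) = (LINT x|lebesgue. indicator (cbox 0 (\<chi> i. 2 * pi)) x *\<^sub>R f x)"
    unfolding torus_def by (rule integral_restrict_space) auto
  also have "\<dots> = (LINT x|lborel. indicator (cbox 0 (\<chi> i. 2 * pi)) x *\<^sub>R f x)"
    by (rule integral_completion) simp
  finally show ?thesis .
qed

lemma prod_cis: "(\<Prod>i\<in>A. cis (f i)) = cis (\<Sum>i\<in>A. f i)"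
  by (induction A rule: infinite_finite_induct) (simp_all add: cis_mult)

lemma prod_Basis_cart:
  fixes g :: "real ^ 'd \<Rightarrow> 'b::comm_monoid_mult"
  shows "(\<Prod>b\<in>Basis. g b) = (\<Prod>i\<in>UNIV. g (axis i 1))"
proof (rule prod.reindex_bij_betw[symmetric])
  show "bij_betw (\<lambda>i::'d. axis i (1::real)) UNIV Basis"
    by (auto simp: bij_betw_def inj_on_def axis_eq_axis Basis_vec_def)
qed

lemma integral_cis_period:
  fixes k :: int
  shows "(LINT t|lborel. indicator {0..2*pi} t *\<^sub>R cis (real_of_int k * t))
           = (if k = 0 then complex_of_real (2 * pi) else 0)"
proof (cases "k = 0")
  case True
  have "(LINT t|lborel. indicator {0..2*pi} t *\<^sub>R (1::complex)) = of_real (2*pi)"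
    by (subst integral_scaleR_left) (simp_all add: scaleR_conv_of_real)
  with True show ?thesis by simp
next
  case False
  define F where "F = (\<lambda>t. cis (real_of_int k * t) / (\<i> * of_int k))"
  have cis_kp: "cis (real_of_int k * (2 * pi)) = 1"
    by (metis cis_multiple_2pi Ints_of_int mult.commute)
  have "(LINT t|lborel. indicator {0..2*pi} t *\<^sub>R cis (real_of_int k * t)) = F (2*pi) - F 0"
  proof (rule integral_FTC_Icc)
    fix t
    show "(F has_vector_derivative cis (real_of_int k * t)) (at t within {0..2*pi})"
      unfolding F_def has_vector_derivative_def using False
      by (auto intro!: derivative_eq_intros simp: scaleR_conv_of_real field_simps fun_eq_iff)
  qed (auto intro!: continuous_intros)
  also have "\<dots> = 0"
    by (simp add: F_def cis_kp)
  finally show ?thesis using False by simp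
qed

lemma borel_measurable_trig [measurable]: "trig k \<in> borel_measurable borel"
  unfolding trig_def by (intro borel_measurable_continuous_onI continuous_intros)

text \<open>Orthogonality of the exponentials: both the indicator of the cube and
  \<open>trig k\<close> split over the coordinates, and a single nonzero component of
  \<open>k\<close> contributes a vanishing factor.\<close>

lemma integral_trig_torus:
  fixes k :: "int ^ 'd"
  shows "(LINT x|torus. trig k x) = (if k = 0 then complex_of_real ((2 * pi) ^ CARD('d)) else 0)"
proof -
  define f where "f = (\<lambda>(b::real^'d) t. indicator {0..2*pi} t *\<^sub>R cis (((\<chi> i. real_of_int (k $ i)) \<bullet> b) * t))"
  have int: "integrable lborel (f b)" for b
    unfolding f_def
    by (rule borel_integrable_compact) (auto intro!: continuous_intros)
  have "(LINT x|torus. trig k x) = (LINT x|lborel. (\<Prod>b\<in>Basis. f b (x \<bullet> b)))"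
  proof (subst integral_torus_eq)
    show "trig k \<in> borel_measurable borel" by simp
    show "(LINT x|lborel. indicator (cbox 0 (\<chi> i. 2 * pi)) x *\<^sub>R trig k x) =
      (LINT x|lborel. (\<Prod>b\<in>Basis. f b (x \<bullet> b)))"
    proof (intro Bochner_Integration.integral_cong refl)
      fix x :: "real^'d"
      have "(\<Prod>b\<in>Basis. f b (x \<bullet> b)) = (\<Prod>i\<in>UNIV. f (axis i 1) (x $ i))"
        by (simp add: prod_Basis_cart inner_axis)
      also have "\<dots> = (\<Prod>i\<in>UNIV. of_bool (x $ i \<in> {0..2*pi}) * cis (real_of_int (k $ i) * x $ i))"
        by (auto simp: f_def inner_axis indicator_def of_bool_def scaleR_conv_of_real mult.commute intro!: prod.cong)
      also have "\<dots> = (if \<forall>i. x $ i \<in> {0..2*pi} then (\<Prod>i\<in>UNIV. cis (real_of_int (k $ i) * x $ i)) else 0)"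
        by (auto simp: of_bool_def intro: prod_zero)
      also have "(\<Prod>i\<in>UNIV. cis (real_of_int (k $ i) * x $ i)) = trig k x"
        by (simp add: trig_def inner_vec_def prod_cis)
      finally show "indicator (cbox 0 (\<chi> i. 2 * pi)) x *\<^sub>R trig k x = (\<Prod>b\<in>Basis. f b (x \<bullet> b))"
        by (auto simp: indicator_def mem_box_cart)
    qed
  qed
  also have "\<dots> = (\<Prod>b\<in>Basis. LINT t|lborel. f b t)"
    by (rule integral_lborel_prod) (rule int)
  also have "\<dots> = (\<Prod>i\<in>UNIV. LINT t|lborel. f (axis i 1) t)"
    by (rule prod_Basis_cart)
  also have "\<dots> = (\<Prod>i\<in>UNIV. if k $ i = 0 then complex_of_real (2 * pi) else 0)"
    unfolding f_def by (intro prod.cong refl) (simp add: inner_axis integral_cis_period)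
  also have "\<dots> = (if k = 0 then complex_of_real ((2 * pi) ^ CARD('d)) else 0)"
  proof (cases "k = 0")
    case False
    then obtain i where "k $ i \<noteq> 0" by (auto simp: vec_eq_iff)
    then show ?thesis using False by (auto intro: prod_zero)
  qed simp
  finally show ?thesis .
qed

lemma trig_mult_cnj: "trig k x * cnj (trig k' x) = trig (k - k') x"
  unfolding trig_def by (simp add: cis_cnj cis_mult inner_vec_def algebra_simps sum_subtractf)

lemma cmod_trig [simp]: "cmod (trig k x) = 1"
  by (simp add: trig_def)

lemma borel_measurable_torus: "f \<in> borel_measurable borel \<Longrightarrow> f \<in> borel_measurable torus"
  unfolding torus_def by (intro measurable_restrict_space1 measurable_completion) simp

lemma finite_measure_torus: "finite_measure (torus :: (real ^ 'd) measure)"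
  unfolding torus_def by (intro finite_measure_lebesgue_on) simp

lemma integrable_trig_torus: "integrable torus (trig k)"
proof -
  interpret finite_measure "torus :: (real ^ 'a) measure" by (rule finite_measure_torus)
  show ?thesis
    by (rule integrable_const_bound[where B = 1]) (auto intro: borel_measurable_torus)
qed

lemma fourier_coeff_trig: "fourier_coeff (trig k) k' = of_bool (k = k')"
  unfolding fourier_coeff_def trig_mult_cnj integral_trig_torus by simp

text \<open>The map \<open>\<kappa>\<close> need not be injective. Expanding the square leaves
  exactly the pairs with equal frequency, so repeated frequencies are counted with multiplicity;
  this is what makes the kernels below large in \<open>L\<^sub>2\<close>.\<close>

lemma parseval_trig:
  fixes \<kappa> :: "'a \<Rightarrow> int ^ 'd"
  assumes "finite A"
  shows "(LINT x|torus. (cmod (\<Sum>a\<in>A. trig (\<kappa> a) x))\<^sup>2)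
           = (2 * pi) ^ CARD('d) * real (card {(a, b) \<in> A \<times> A. \<kappa> a = \<kappa> b})"
proof -
  have "complex_of_real (LINT x|torus. (cmod (\<Sum>a\<in>A. trig (\<kappa> a) x))\<^sup>2)
      = (LINT x|torus. (\<Sum>a\<in>A. \<Sum>b\<in>A. trig (\<kappa> a - \<kappa> b) x))"
    unfolding integral_complex_of_real[symmetric] complex_norm_square
    by (simp add: sum_product trig_mult_cnj)
  also have "\<dots> = (\<Sum>a\<in>A. \<Sum>b\<in>A. (LINT x|torus. trig (\<kappa> a - \<kappa> b) x))"
    by (simp add: integrable_trig_torus)
  also have "\<dots> = complex_of_real ((2 * pi) ^ CARD('d)) * (\<Sum>a\<in>A. \<Sum>b\<in>A. of_bool (\<kappa> a = \<kappa> b))"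
    unfolding sum_distrib_left by (intro sum.cong refl) (simp add: integral_trig_torus)
  also have "(\<Sum>a\<in>A. \<Sum>b\<in>A. of_bool (\<kappa> a = \<kappa> b) :: complex) = (\<Sum>z\<in>A\<times>A. of_bool (\<kappa> (fst z) = \<kappa> (snd z)))"
    by (simp add: sum.cartesian_product case_prod_beta)
  also have "\<dots> = of_nat (card {(a, b) \<in> A \<times> A. \<kappa> a = \<kappa> b})"
    using assms by (simp add: of_bool_def sum.If_cases Int_def case_prod_unfold conj_assoc mem_Times_iff)
  finally have "complex_of_real (LINT x|torus. (cmod (\<Sum>a\<in>A. trig (\<kappa> a) x))\<^sup>2)
      = complex_of_real ((2 * pi) ^ CARD('d) * real (card {(a, b) \<in> A \<times> A. \<kappa> a = \<kappa> b}))"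
    by simp
  then show ?thesis
    by (simp only: of_real_eq_iff)
qed

section \<open>Lebesgue norms\<close>

lemma enn_powr_ennreal: "0 \<le> c \<Longrightarrow> enn_powr (ennreal c) a = ennreal (c powr a)"
  by (simp add: enn_powr_def)

lemma enn_powr_top [simp]: "enn_powr top a = top"
  by (simp add: enn_powr_def)

lemma enn_powr_mono:
  assumes "0 < a" "x \<le> y"
  shows "enn_powr x a \<le> enn_powr y a"
  using assms by (cases x; cases y) (auto simp: enn_powr_ennreal powr_mono2 ennreal_leI top_unique)

lemma enn_powr_inverse:
  assumes "0 < a"
  shows "enn_powr (enn_powr x a) (1 / a) = x"
  using assms by (cases x) (auto simp: enn_powr_ennreal powr_powr)

lemma enn_powr_inverse':
  assumes "0 < a"
  shows "enn_powr (enn_powr x (1 / a)) a = x"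
  using assms by (cases x) (auto simp: enn_powr_ennreal powr_powr)

lemma enn_powr_cmult:
  assumes "0 < c"
  shows "enn_powr (ennreal c * x) a = ennreal (c powr a) * enn_powr x a"
  using assms by (cases x) (auto simp: enn_powr_ennreal powr_mult ennreal_mult_top simp flip: ennreal_mult)

lemma borel_measurable_enn_powr [measurable]:
  assumes [measurable]: "f \<in> borel_measurable M"
  shows "(\<lambda>x. enn_powr (f x) a) \<in> borel_measurable M"
  unfolding enn_powr_def by measurable

lemma recip_ennreal: "0 < P \<Longrightarrow> recip (ennreal P) = 1 / P"
  unfolding recip_def by (simp add: divide_ennreal flip: ennreal_1)

lemma recip_top [simp]: "recip top = 0"
  by (simp add: recip_def)

lemma ennreal_exponent_cases [consumes 1, case_names top real]:
  assumes "1 \<le> p"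
  obtains "p = top" | P where "p = ennreal P" "1 \<le> P"
  using assms by (cases p) (auto simp: ennreal_1[symmetric] simp del: ennreal_1)

section \<open>Estimates for Lebesgue norms of functions and families\<close>

lemma eLp_norm_ennreal:
  "0 < P \<Longrightarrow> eLp_norm (ennreal P) M f = enn_powr (\<integral>\<^sup>+x. enn_powr (f x) P \<partial>M) (1 / P)"
  by (simp add: eLp_norm_def recip_ennreal)

lemma eLp_norm_le_iff:
  assumes "0 < P" "0 \<le> c"
  shows "eLp_norm (ennreal P) M f \<le> ennreal c \<longleftrightarrow> (\<integral>\<^sup>+x. enn_powr (f x) P \<partial>M) \<le> ennreal (c powr P)"
  using assms unfolding eLp_norm_ennreal[OF assms(1)]
  by (metis enn_powr_ennreal enn_powr_inverse enn_powr_inverse' enn_powr_mono zero_less_divide_1_iff)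

lemma eLp_norm_ge:
  assumes "0 < P" "0 \<le> c" "ennreal (c powr P) \<le> (\<integral>\<^sup>+x. enn_powr (f x) P \<partial>M)"
  shows "ennreal c \<le> eLp_norm (ennreal P) M f"
  using assms unfolding eLp_norm_ennreal[OF assms(1)]
  by (metis enn_powr_ennreal enn_powr_inverse enn_powr_mono zero_less_divide_1_iff)

lemma eLp_norm_mono:
  assumes "1 \<le> p" "f \<in> borel_measurable M" "\<And>x. f x \<le> g x"
  shows "eLp_norm p M f \<le> eLp_norm p M g"
  using assms(1)
proof (cases rule: ennreal_exponent_cases)
  case top
  then show ?thesis using assms by (simp add: eLp_norm_def esssup_mono)
next
  case (real P)
  then show ?thesis
    using assms(3) by (auto simp: eLp_norm_ennreal intro!: enn_powr_mono nn_integral_mono)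
qed

text \<open>A triangle inequality with a lossy constant: \<open>h \<le> 2 * max f g\<close>, and the
  \<open>P\<close>-th power of the maximum is at most the sum of the two powers. The factor 4 comes
  from 2 * 2^P \<le> 4^P, valid for P \<ge> 1.\<close>

lemma eLp_norm_add_le:
  assumes "1 \<le> P" "0 \<le> a" "eLp_norm (ennreal P) M f \<le> ennreal a" "eLp_norm (ennreal P) M g \<le> ennreal a"
    and [measurable]: "f \<in> borel_measurable M" "g \<in> borel_measurable M"
    and "\<And>x. h x \<le> f x + g x"
  shows "eLp_norm (ennreal P) M h \<le> ennreal (4 * a)"
proof -
  have "enn_powr (h x) P \<le> ennreal (2 powr P) * (enn_powr (f x) P + enn_powr (g x) P)" for x
  proof -
    have "h x \<le> ennreal 2 * max (f x) (g x)"
      using assms(7)[of x] by (simp add: mult_2 max_def) (metis add_mono order_trans linear order_refl)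
    then have "enn_powr (h x) P \<le> ennreal (2 powr P) * enn_powr (max (f x) (g x)) P"
      using enn_powr_mono[of P "h x" "ennreal 2 * max (f x) (g x)"]
        enn_powr_cmult[of 2 "max (f x) (g x)" P] assms(1) by simp
    also have "enn_powr (max (f x) (g x)) P \<le> enn_powr (f x) P + enn_powr (g x) P"
      by (auto simp: max_def)
    finally show ?thesis by (simp add: mult_left_mono)
  qed
  then have "(\<integral>\<^sup>+x. enn_powr (h x) P \<partial>M)
      \<le> (\<integral>\<^sup>+x. ennreal (2 powr P) * (enn_powr (f x) P + enn_powr (g x) P) \<partial>M)"
    by (intro nn_integral_mono)
  also have "\<dots> = ennreal (2 powr P) * ((\<integral>\<^sup>+x. enn_powr (f x) P \<partial>M) + (\<integral>\<^sup>+x. enn_powr (g x) P \<partial>M))"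
    by (simp add: nn_integral_cmult nn_integral_add)
  also have "\<dots> \<le> ennreal (2 powr P) * (ennreal (a powr P) + ennreal (a powr P))"
    using assms by (intro mult_left_mono add_mono) (auto simp: eLp_norm_le_iff)
  also have "\<dots> = ennreal (2 powr P * 2 * a powr P)"
    by (simp add: ennreal_mult mult.assoc flip: mult_2)
  also have "\<dots> \<le> ennreal ((4 * a) powr P)"
  proof (rule ennreal_leI)
    have "(2::real) * 2 powr P \<le> 2 powr P * 2 powr P"
      using powr_mono[of 1 P "2::real"] assms(1) by simp
    also have "\<dots> = 4 powr P" by (simp flip: powr_mult)
    finally show "2 powr P * 2 * a powr P \<le> (4 * a) powr P"
      using assms(2) mult_right_mono[of "2 * 2 powr P" "4 powr P" "a powr P"] by (simp add: powr_mult mult_ac)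
  qed
  finally show ?thesis using assms by (simp add: eLp_norm_le_iff)
qed

text \<open>Interpolation between \<open>L\<^sub>1\<close> and \<open>L\<^sub>\<infinity>\<close>:
  pointwise, f^P \<le> B^(P-1) * f.\<close>

lemma eLp_norm_le_interpolation:
  fixes f :: "'a \<Rightarrow> real"
  assumes "1 \<le> p" and [measurable]: "f \<in> borel_measurable M"
    and "\<And>x. 0 \<le> f x" "\<And>x. f x \<le> B" "0 < B"
    and "(\<integral>\<^sup>+x. ennreal (f x) \<partial>M) \<le> ennreal J" "0 < J"
  shows "eLp_norm p M (\<lambda>x. ennreal (f x)) \<le> ennreal (J powr recip p * B powr (1 - recip p))"
  using assms(1)
proof (cases rule: ennreal_exponent_cases)
  case top
  then show ?thesis using assms
    by (auto simp: eLp_norm_def intro!: esssup_I ennreal_leI)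
next
  case (real P)
  have "enn_powr (ennreal (f x)) P \<le> ennreal (B powr (P - 1)) * ennreal (f x)" for x
  proof (cases "f x = 0")
    case False
    then have "f x powr P = f x powr (P - 1) * f x"
      using assms(3)[of x] powr_add[of "f x" "P - 1" 1] by simp
    also have "\<dots> \<le> B powr (P - 1) * f x"
      using assms real by (intro mult_right_mono powr_mono2) auto
    finally show ?thesis
      using assms(3)[of x] by (simp add: enn_powr_ennreal flip: ennreal_mult)
  qed (use real in \<open>simp add: enn_powr_def\<close>)
  then have "(\<integral>\<^sup>+x. enn_powr (ennreal (f x)) P \<partial>M) \<le> (\<integral>\<^sup>+x. ennreal (B powr (P - 1)) * ennreal (f x) \<partial>M)"
    by (intro nn_integral_mono)
  also have "\<dots> \<le> ennreal (B powr (P - 1)) * ennreal J"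
    using assms by (simp add: nn_integral_cmult mult_left_mono)
  also have "\<dots> = ennreal ((J powr (1 / P) * B powr (1 - 1 / P)) powr P)"
  proof -
    have "(1 - 1 / P) * P = P - 1" using real by (simp add: field_simps)
    then show ?thesis using assms real by (simp add: powr_mult powr_powr mult.commute flip: ennreal_mult)
  qed
  finally show ?thesis using real by (simp add: eLp_norm_le_iff recip_ennreal)
qed

text \<open>The threshold \<open>T\<close> is free: a large second moment compared with
  \<open>T\<close> times the first moment means that much of the mass sits where \<open>f\<close>
  exceeds \<open>T\<close>, and there the power q > 2 gains a factor T^(q-2) over the
  square.\<close>

lemma eLp_norm_ge_interpolation:
  fixes f :: "'a \<Rightarrow> real"
  assumes "2 < q" and f: "\<And>x. 0 \<le> f x" and "0 < T"
    and int1: "integrable M f" and int2: "integrable M (\<lambda>x. (f x)\<^sup>2)"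
    and "0 \<le> c" and c: "c powr q \<le> T powr (q - 2) * ((LINT x|M. (f x)\<^sup>2) - T * (LINT x|M. f x))"
  shows "ennreal c \<le> eLp_norm (ennreal q) M (\<lambda>x. ennreal (f x))"
proof (rule eLp_norm_ge)
  \<comment> \<open>Where \<open>f \<ge> T\<close>, the left-hand side is at most \<open>T powr (q - 2) * (f x)\<^sup>2 \<le> f x powr q\<close>;
    elsewhere it is nonpositive.\<close>
  have pt: "T powr (q - 2) * ((f x)\<^sup>2 - T * f x) \<le> f x powr q" for x
  proof (cases "f x \<le> T")
    case True
    then have "(f x)\<^sup>2 - T * f x \<le> 0"
      using f[of x] by (simp add: power2_eq_square mult_right_mono)
    then have "T powr (q - 2) * ((f x)\<^sup>2 - T * f x) \<le> 0"
      by (simp add: mult_nonneg_nonpos)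
    then show ?thesis by (smt (verit) powr_ge_zero)
  next
    case False
    then have "T powr (q - 2) * ((f x)\<^sup>2 - T * f x) \<le> f x powr (q - 2) * (f x)\<^sup>2"
      using assms f[of x] by (intro mult_mono powr_mono2) (auto simp: power2_eq_square algebra_simps intro!: mult_left_mono)
    also have "\<dots> = f x powr q"
      using False assms(3) powr_add[of "f x" "q - 2" 2] by (simp add: powr_numeral)
    finally show ?thesis .
  qed
  have int: "integrable M (\<lambda>x. T powr (q - 2) * ((f x)\<^sup>2 - T * f x))"
    using int1 int2 by auto
  have "ennreal (c powr q) \<le> ennreal (LINT x|M. T powr (q - 2) * ((f x)\<^sup>2 - T * f x))"
    using c int1 int2 by (intro ennreal_leI) simp
  also have "\<dots> \<le> (\<integral>\<^sup>+x. ennreal (T powr (q - 2) * ((f x)\<^sup>2 - T * f x)) \<partial>M)"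
  proof -
    have "(LINT x|M. T powr (q - 2) * ((f x)\<^sup>2 - T * f x))
        \<le> (LINT x|M. max 0 (T powr (q - 2) * ((f x)\<^sup>2 - T * f x)))"
      using int by (intro integral_mono) auto
    also have "ennreal \<dots> = (\<integral>\<^sup>+x. ennreal (max 0 (T powr (q - 2) * ((f x)\<^sup>2 - T * f x))) \<partial>M)"
      using int by (intro nn_integral_eq_integral[symmetric]) auto
    finally show ?thesis
      by (simp add: ennreal_max_0 ennreal_leI)
  qed
  also have "\<dots> \<le> (\<integral>\<^sup>+x. enn_powr (ennreal (f x)) q \<partial>M)"
    using f pt by (intro nn_integral_mono) (auto simp: enn_powr_ennreal intro!: ennreal_leI)
  finally show "ennreal (c powr q) \<le> (\<integral>\<^sup>+x. enn_powr (ennreal (f x)) q \<partial>M)" .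
qed (use assms in auto)

text \<open>Each term is at most 1, so raising it to a power P \<ge> 1 does not increase it. One
  \<open>l\<^sub>1\<close> bound thus serves all the exponents \<theta> of the Besov norms.\<close>

lemma eLp_norm_count_space_le_1:
  assumes "1 \<le> p" and sum: "(\<integral>\<^sup>+m. a m \<partial>count_space UNIV) \<le> 1"
  shows "eLp_norm p (count_space UNIV) a \<le> 1"
proof -
  have a1: "a m \<le> 1" for m
    using nn_integral_ge_point[of m UNIV a] sum by auto
  show ?thesis using assms(1)
  proof (cases rule: ennreal_exponent_cases)
    case top
    then show ?thesis using a1
      by (auto simp: eLp_norm_def intro!: esssup_I)
  next
    case (real P)
    have "enn_powr (a m) P \<le> a m" for m
    proof (cases "a m")
      case (real u)
      then have "u \<le> 1" using a1[of m] by (simp flip: ennreal_1)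
      then have "u powr P \<le> u powr 1" if "u \<noteq> 0"
        using that real \<open>1 \<le> P\<close> by (intro powr_mono') auto
      then show ?thesis using real by (cases "u = 0") (auto simp: enn_powr_ennreal simp flip: ennreal_0 intro: ennreal_leI)
    qed simp
    then have "(\<integral>\<^sup>+m. enn_powr (a m) P \<partial>count_space UNIV) \<le> (\<integral>\<^sup>+m. a m \<partial>count_space UNIV)"
      by (intro nn_integral_mono)
    with sum have "(\<integral>\<^sup>+m. enn_powr (a m) P \<partial>count_space UNIV) \<le> ennreal (1 powr P)"
      by simp
    then show ?thesis
      using real eLp_norm_le_iff[of P 1 "count_space UNIV" a] by simp
  qed
qed

text \<open>Used to bound a single weighted dyadic block by the whole Besov norm.\<close>

lemma le_eLp_norm_count_space:
  assumes "0 < P"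
  shows "a m \<le> eLp_norm (ennreal P) (count_space UNIV) a"
proof -
  have "enn_powr (a m) P \<le> (\<integral>\<^sup>+m. enn_powr (a m) P \<partial>count_space UNIV)"
    by (rule nn_integral_ge_point) simp
  then show ?thesis
    using enn_powr_mono[of "1 / P"] enn_powr_inverse[OF assms, of "a m"] assms
    by (metis eLp_norm_ennreal zero_less_divide_1_iff)
qed

lemma suminf_geometric_ennreal:
  assumes "0 \<le> w" "w < (1::real)" "0 \<le> C"
  shows "(\<Sum>K. ennreal (C * w ^ K)) = ennreal (C / (1 - w))"
proof (rule suminf_ennreal_eq)
  show "(\<lambda>K. C * w ^ K) sums (C / (1 - w))"
    using sums_mult[OF geometric_sums[of w], of C] assms by simp
qed (use assms in auto)

\<comment> \<open>Countable Minkowski is avoided: with geometric weights the sum is dominated by a multiple of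
  the supremum of the reweighted terms, whose \<open>P\<close>-th power is at most the sum of the \<open>P\<close>-th powers.\<close>
lemma eLp_norm_suminf_finite:
  assumes "1 \<le> p" and [measurable]: "\<And>K. f K \<in> borel_measurable M"
    and le: "\<And>K::nat. eLp_norm p M (f K) \<le> ennreal (C * \<rho> ^ K)"
    and "0 \<le> C" "0 < \<rho>" "\<rho> < 1"
  shows "eLp_norm p M (\<lambda>x. \<Sum>K. f K x) < \<infinity>"
  using assms(1)
proof (cases rule: ennreal_exponent_cases)
  case top
  have "AE x in M. f K x \<le> ennreal (C * \<rho> ^ K)" for K
    using esssup_AE[of "f K" M] by eventually_elim (use le[of K] top in \<open>auto simp: eLp_norm_def\<close>)
  then have "AE x in M. \<forall>K. f K x \<le> ennreal (C * \<rho> ^ K)"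
    by (simp add: AE_all_countable)
  then have "AE x in M. (\<Sum>K. f K x) \<le> ennreal (C / (1 - \<rho>))"
  proof eventually_elim
    case (elim x)
    then have "(\<Sum>K. f K x) \<le> (\<Sum>K. ennreal (C * \<rho> ^ K))"
      by (intro suminf_le) auto
    also have "\<dots> = ennreal (C / (1 - \<rho>))"
      using assms by (intro suminf_geometric_ennreal) auto
    finally show ?case .
  qed
  then have "esssup M (\<lambda>x. \<Sum>K. f K x) \<le> ennreal (C / (1 - \<rho>))"
    by (intro esssup_I) auto
  then show ?thesis using top by (simp add: eLp_norm_def le_less_trans)
next
  case (real P)
  \<comment> \<open>The square root splits the decay \<rho>^K in two equal parts: one factor w^K
    gives the convergent geometric sum outside \<open>S\<close>, the other makes \<open>S\<close>
    integrable.\<close>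
  define w where "w = sqrt \<rho>"
  have w: "0 < w" "w < 1" "w\<^sup>2 = \<rho>" using assms by (auto simp: w_def)
  define S where "S x = (\<Sum>K. enn_powr (ennreal (1 / w ^ K) * f K x) P)" for x
  have [measurable]: "S \<in> borel_measurable M" unfolding S_def by measurable
  have f_le: "f K x \<le> enn_powr (S x) (1 / P) * ennreal (1 * w ^ K)" for K x
  proof -
    have "enn_powr (ennreal (1 / w ^ K) * f K x) P \<le> S x"
      unfolding S_def using sum_le_suminf[of "\<lambda>K. enn_powr (ennreal (1 / w ^ K) * f K x) P" "{K}"] by simp
    then have "ennreal (1 / w ^ K) * f K x \<le> enn_powr (S x) (1 / P)"
      using real enn_powr_mono[of "1 / P"] enn_powr_inverse[of P]
      by (metis less_le_trans zero_less_divide_1_iff zero_less_one)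
    then have "ennreal (w ^ K) * (ennreal (1 / w ^ K) * f K x) \<le> ennreal (w ^ K) * enn_powr (S x) (1 / P)"
      by (rule mult_left_mono) simp
    moreover have "ennreal (w ^ K) * (ennreal (1 / w ^ K) * f K x) = f K x"
      using w by (simp add: mult.assoc[symmetric] flip: ennreal_mult)
    ultimately show ?thesis by (simp add: mult.commute)
  qed
  have "(\<integral>\<^sup>+x. enn_powr (\<Sum>K. f K x) P \<partial>M) \<le> (\<integral>\<^sup>+x. ennreal ((1 / (1 - w)) powr P) * S x \<partial>M)"
  proof (rule nn_integral_mono)
    fix x
    have "(\<Sum>K. f K x) \<le> (\<Sum>K. enn_powr (S x) (1 / P) * ennreal (1 * w ^ K))"
      using f_le by (intro suminf_le) auto
    also have "\<dots> = enn_powr (S x) (1 / P) * (\<Sum>K. ennreal (1 * w ^ K))"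
      by (rule ennreal_suminf_cmult)
    also have "\<dots> = ennreal (1 / (1 - w)) * enn_powr (S x) (1 / P)"
      using w by (simp only: suminf_geometric_ennreal mult.commute less_imp_le zero_le_one)
    finally have "enn_powr (\<Sum>K. f K x) P \<le> enn_powr (ennreal (1 / (1 - w)) * enn_powr (S x) (1 / P)) P"
      using real by (intro enn_powr_mono) auto
    also have "\<dots> = ennreal ((1 / (1 - w)) powr P) * S x"
      using real w enn_powr_cmult[of "1 / (1 - w)" "enn_powr (S x) (1 / P)" P]
      by (simp add: enn_powr_inverse')
    finally show "enn_powr (\<Sum>K. f K x) P \<le> ennreal ((1 / (1 - w)) powr P) * S x" .
  qed
  also have "\<dots> = ennreal ((1 / (1 - w)) powr P) * (\<Sum>K. \<integral>\<^sup>+x. enn_powr (ennreal (1 / w ^ K) * f K x) P \<partial>M)"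
    unfolding S_def by (subst nn_integral_cmult, measurable, subst nn_integral_suminf) simp_all
  also have "\<dots> \<le> ennreal ((1 / (1 - w)) powr P) * (\<Sum>K. ennreal (C powr P * (w powr P) ^ K))"
  proof (intro mult_left_mono suminf_le)
    fix K
    have "(\<integral>\<^sup>+x. enn_powr (ennreal (1 / w ^ K) * f K x) P \<partial>M)
        = ennreal ((1 / w ^ K) powr P) * (\<integral>\<^sup>+x. enn_powr (f K x) P \<partial>M)"
      using w by (subst enn_powr_cmult) (simp_all add: nn_integral_cmult)
    also have "\<dots> \<le> ennreal ((1 / w ^ K) powr P) * ennreal ((C * \<rho> ^ K) powr P)"
      using le[of K] real assms by (intro mult_left_mono) (auto simp: eLp_norm_le_iff)
    also have "\<dots> = ennreal ((1 / w ^ K * (C * \<rho> ^ K)) powr P)"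
      using w assms by (subst ennreal_mult[symmetric]) (simp_all flip: powr_mult)
    also have "1 / w ^ K * (C * \<rho> ^ K) = C * w ^ K"
      using w by (simp add: field_simps flip: w(3)) (simp add: power2_eq_square power_mult_distrib)
    also have "(C * w ^ K) powr P = C powr P * (w powr P) ^ K"
    proof -
      have "(w ^ K) powr P = w powr (real K * P)"
        using w by (simp only: powr_realpow[symmetric] powr_powr)
      also have "\<dots> = (w powr P) powr real K"
        by (simp only: powr_powr mult.commute)
      also have "\<dots> = (w powr P) ^ K"
        using w by (intro powr_realpow) simp
      finally show ?thesis using w assms by (simp add: powr_mult)
    qed
    finally show "(\<integral>\<^sup>+x. enn_powr (ennreal (1 / w ^ K) * f K x) P \<partial>M) \<le> ennreal (C powr P * (w powr P) ^ K)" .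
  qed auto
  also have "\<dots> < \<infinity>"
  proof -
    have "w powr P < 1" using w real powr_less_mono2[of P w 1] by simp
    then show ?thesis by (simp add: suminf_geometric_ennreal ennreal_mult_less_top)
  qed
  finally show ?thesis
    using real by (cases "\<integral>\<^sup>+x. enn_powr (\<Sum>K. f K x) P \<partial>M") (auto simp: eLp_norm_ennreal enn_powr_ennreal)
qed

text \<open>The torus has finite measure and |f| \<le> 1 + |f|^P. Integrability is what additivity
  of Fourier coefficients requires.\<close>

lemma Lp_torus_integrable:
  fixes f :: "real ^ 'd \<Rightarrow> complex"
  assumes "1 \<le> P" "f \<in> Lp_torus (ennreal P)"
  shows "integrable torus f"
proof -
  interpret finite_measure "torus :: (real ^ 'd) measure" by (rule finite_measure_torus)
  have [measurable]: "f \<in> borel_measurable torus" using assms by (simp add: Lp_torus_def)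
  have "eLp_norm (ennreal P) torus (\<lambda>x. ennreal (cmod (f x))) < \<infinity>"
    using assms by (simp add: Lp_torus_def)
  then have fin: "(\<integral>\<^sup>+x. enn_powr (ennreal (cmod (f x))) P \<partial>torus) < \<infinity>"
    using assms(1) by (cases "\<integral>\<^sup>+x. enn_powr (ennreal (cmod (f x))) P \<partial>torus") (auto simp: eLp_norm_ennreal)
  have "(\<integral>\<^sup>+x. ennreal (norm (f x)) \<partial>torus) \<le> (\<integral>\<^sup>+x. 1 + enn_powr (ennreal (cmod (f x))) P \<partial>torus)"
  proof (rule nn_integral_mono)
    fix x
    have "cmod (f x) \<le> 1 + cmod (f x) powr P"
    proof (cases "cmod (f x) \<le> 1")
      case False
      then have "cmod (f x) powr 1 \<le> cmod (f x) powr P" using assms(1) by (intro powr_mono) auto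
      then show ?thesis using False by simp
    qed (smt (verit) powr_ge_zero)
    then show "ennreal (norm (f x)) \<le> 1 + enn_powr (ennreal (cmod (f x))) P"
      by (simp add: enn_powr_ennreal ennreal_leI flip: ennreal_1 ennreal_plus)
  qed
  also have "\<dots> = emeasure torus (space (torus :: (real ^ 'd) measure)) + (\<integral>\<^sup>+x. enn_powr (ennreal (cmod (f x))) P \<partial>torus)"
    by (subst nn_integral_add) auto
  also have "\<dots> < \<infinity>" using fin by (simp add: less_top[symmetric])
  finally show ?thesis by (intro integrableI_bounded) auto
qed

section \<open>Squared Dirichlet kernels\<close>

lemma axis_add: "axis e (a + b) = axis e a + (axis e b :: 'a::monoid_add ^ 'd)"
  by (simp add: axis_def vec_eq_iff)

lemma trig_add: "trig (k + k') x = trig k x * trig k' x"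
  unfolding trig_def by (simp add: cis_mult inner_vec_def algebra_simps sum.distrib)

text \<open>Cauchy-Schwarz for the fibre sizes of \<open>h\<close>: they sum to
  \<open>card A\<close>, and their squares sum to the number of colliding pairs.\<close>

lemma card_square_le_collisions:
  fixes h :: "'a \<Rightarrow> 'b"
  assumes "finite A" "finite S" "h ` A \<subseteq> S"
  shows "(real (card A))\<^sup>2 \<le> real (card {(a, b) \<in> A \<times> A. h a = h b}) * real (card S)"
proof -
  define F where "F s = {a \<in> A. h a = s}" for s
  have "card {(a, b) \<in> A \<times> A. h a = h b} = (\<Sum>a\<in>A. card (F (h a)))"
  proof -
    have "{(a, b) \<in> A \<times> A. h a = h b} = (SIGMA a:A. F (h a))"
      by (auto simp: F_def)
    then show ?thesis using assms by (simp add: F_def)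
  qed
  also have "\<dots> = (\<Sum>s\<in>S. \<Sum>a\<in>F s. card (F (h a)))"
    unfolding F_def using assms by (intro sum.group[symmetric]) auto
  also have "\<dots> = (\<Sum>s\<in>S. (card (F s))\<^sup>2)"
    by (intro sum.cong refl) (simp add: F_def power2_eq_square)
  finally have coll: "real (card {(a, b) \<in> A \<times> A. h a = h b}) = (\<Sum>s\<in>S. (real (card (F s)))\<^sup>2)"
    by simp
  have "card A = (\<Sum>a\<in>A. 1)" by simp
  also have "\<dots> = (\<Sum>s\<in>S. card (F s))"
    unfolding F_def using assms by (subst sum.group[symmetric, of A S h]) auto
  finally have "real (card A) = (\<Sum>s\<in>S. real (card (F s)))" by simp
  then show ?thesis
    unfolding coll using sum_squared_le_sum_of_squares[of "\<lambda>s. real (card (F s))" S] by simp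
qed

text \<open>A squared Dirichlet kernel in the coordinate \<open>e\<close>, modulated to have its top
  frequency at 2^K. It is written as a sum over pairs of indices, with repeated frequencies, so that
  Parseval reduces its \<open>L\<^sub>2\<close> norm to counting.\<close>

definition bump :: "'d \<Rightarrow> nat \<Rightarrow> nat \<Rightarrow> real ^ 'd \<Rightarrow> complex" where
  "bump e K M x =
     (\<Sum>a\<in>{..<M} \<times> {..<M}. trig (axis e (2 ^ K - int (fst a) - int (snd a))) x)"

lemma borel_measurable_bump [measurable]: "bump e K M \<in> borel_measurable borel"
  unfolding bump_def by measurable

text \<open>The modulation has modulus 1. Since the modulus is itself a square, the
  \<open>L\<^sub>1\<close> norm of the kernel is the squared \<open>L\<^sub>2\<close> norm of a
  Dirichlet kernel and can be computed exactly.\<close>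

lemma cmod_bump: "cmod (bump e K M x) = (cmod (\<Sum>i<M. trig (axis e (- int i)) x))\<^sup>2"
proof -
  have "bump e K M x = (\<Sum>a\<in>{..<M} \<times> {..<M}. trig (axis e (2 ^ K)) x *
      (trig (axis e (- int (fst a))) x * trig (axis e (- int (snd a))) x))"
    unfolding bump_def
  proof (intro sum.cong refl)
    fix a :: "nat \<times> nat"
    have "2 ^ K - int (fst a) - int (snd a) = 2 ^ K + (- int (fst a) + - int (snd a))" by simp
    then show "trig (axis e (2 ^ K - int (fst a) - int (snd a))) x = trig (axis e (2 ^ K)) x *
        (trig (axis e (- int (fst a))) x * trig (axis e (- int (snd a))) x)"
      by (simp only: axis_add trig_add)
  qed
  also have "\<dots> = trig (axis e (2 ^ K)) x * (\<Sum>i<M. trig (axis e (- int i)) x)\<^sup>2"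
    unfolding power2_eq_square sum_product sum.cartesian_product
    by (simp add: sum_distrib_left case_prod_beta)
  finally show ?thesis by (simp add: norm_mult norm_power)
qed

lemma cmod_bump_le: "cmod (bump e K M x) \<le> (real M)\<^sup>2"
proof -
  have "cmod (\<Sum>i<M. trig (axis e (- int i)) x) \<le> real M"
    using sum_norm_bound[of "{..<M}" "\<lambda>i. trig (axis e (- int i)) x" 1] by simp
  then show ?thesis
    by (simp add: cmod_bump power_mono)
qed

lemma integrable_torus_bounded:
  fixes f :: "real ^ 'd \<Rightarrow> 'b::{banach,second_countable_topology}"
  assumes "f \<in> borel_measurable borel" "\<And>x. norm (f x) \<le> B"
  shows "integrable torus f"
proof -
  interpret finite_measure "torus :: (real ^ 'd) measure" by (rule finite_measure_torus)
  have "f \<in> borel_measurable torus"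
    using assms(1) by (rule borel_measurable_torus)
  then show ?thesis
    by (intro integrable_const_bound[where B = B]) (use assms in auto)
qed

lemma integral_cmod_bump:
  "(LINT x|torus. cmod (bump e K M x)) = (2 * pi) ^ CARD('d) * real M"
  for e :: "'d::finite"
proof -
  have "{(a, b) \<in> {..<M} \<times> {..<M}. axis e (- int a) = axis e (- int b)} = (\<lambda>a. (a, a)) ` {..<M}"
    by (auto simp: axis_eq_axis)
  then show ?thesis
    unfolding cmod_bump by (subst parseval_trig) (simp_all add: card_image inj_on_def)
qed

text \<open>The M^2 index pairs share fewer than 2M possible sums, so at least M^4 / (2M) = M^3 / 2
  pairs of index pairs collide.\<close>

lemma integral_cmod_bump_square:
  "(2 * pi) ^ CARD('d) * (real M ^ 3 / 2) \<le> (LINT x|torus. (cmod (bump e K M x))\<^sup>2)"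
  for e :: "'d::finite"
proof (cases "M = 0")
  case False
  define A where "A = {..<M} \<times> {..<M}"
  define N where "N = card {(a, b) \<in> A \<times> A.
      axis e (2 ^ K - int (fst a) - int (snd a)) = axis e (2 ^ K - int (fst b) - int (snd b))}"
  have "N = card {(a, b) \<in> A \<times> A. fst a + snd a = fst b + snd b}"
    unfolding N_def by (intro arg_cong[where f = card]) (auto simp: axis_eq_axis)
  moreover have "(real (card A))\<^sup>2 \<le> real (card {(a, b) \<in> A \<times> A. fst a + snd a = fst b + snd b}) * real (card {..<2 * M})"
    by (rule card_square_le_collisions) (auto simp: A_def)
  ultimately have "(real M * real M)\<^sup>2 \<le> real N * (2 * real M)"
    by (simp add: A_def)
  then have "real M ^ 3 / 2 \<le> real N"
    using False by (simp add: power2_eq_square power3_eq_cube)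
  moreover have "(LINT x|torus. (cmod (bump e K M x))\<^sup>2) = (2 * pi) ^ CARD('d) * real N"
    unfolding bump_def N_def A_def by (subst parseval_trig) auto
  ultimately show ?thesis by (simp add: mult_left_mono)
qed (simp add: bump_def)

lemma recip_bounds:
  assumes "1 \<le> p"
  shows "0 \<le> recip p" "recip p \<le> 1"
  using assms by (cases rule: ennreal_exponent_cases; simp add: recip_ennreal)+

text \<open>Interpolates between the exact \<open>L\<^sub>1\<close> norm, of order M, and the sup
  bound M^2. The volume factor D \<ge> 1 enters to the power 1/p and is bounded by \<open>D\<close>
  itself, making the constant uniform in \<open>p\<close>.\<close>

lemma eLp_norm_bump_le:
  fixes e :: "'d::finite"
  assumes "1 \<le> p" "0 < c" "0 < M"
  shows "eLp_norm p torus (\<lambda>x. ennreal (cmod (complex_of_real c * bump e K M x)))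
           \<le> ennreal ((2 * pi) ^ CARD('d) * c * real M powr (2 - recip p))"
proof -
  define D where "D = (2 * pi) ^ CARD('d)"
  define \<rho> where "\<rho> = recip p"
  have sq: "(real M)\<^sup>2 = real M powr 2" using assms by simp
  have "1 \<le> 2 * pi" using pi_gt3 by linarith
  then have D: "1 \<le> D" unfolding D_def by (rule one_le_power)
  have \<rho>: "0 \<le> \<rho>" "\<rho> \<le> 1" using recip_bounds[OF assms(1)] by (auto simp: \<rho>_def)
  have int: "integrable torus (\<lambda>x. c * cmod (bump e K M x))"
    by (intro integrable_mult_right integrable_torus_bounded[where B = "(real M)\<^sup>2"])
       (auto simp: cmod_bump_le)
  have "eLp_norm p torus (\<lambda>x. ennreal (c * cmod (bump e K M x)))
      \<le> ennreal ((c * (D * real M)) powr recip p * (c * (real M)\<^sup>2) powr (1 - recip p))"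
  proof (rule eLp_norm_le_interpolation)
    show "(\<integral>\<^sup>+x. ennreal (c * cmod (bump e K M x)) \<partial>torus) \<le> ennreal (c * (D * real M))"
      using assms int by (subst nn_integral_eq_integral) (auto simp: integral_cmod_bump D_def)
  qed (use assms D int in \<open>auto simp: cmod_bump_le intro: borel_measurable_torus\<close>)
  also have "\<dots> \<le> ennreal (D * c * real M powr (2 - recip p))"
  proof (rule ennreal_leI)
    have "(c * (D * real M)) powr \<rho> * (c * (real M)\<^sup>2) powr (1 - \<rho>)
        = D powr \<rho> * (c powr \<rho> * c powr (1 - \<rho>)) * (real M powr \<rho> * real M powr (2 * (1 - \<rho>)))"
    proof -
      have "(c * (D * real M)) powr \<rho> = c powr \<rho> * (D powr \<rho> * real M powr \<rho>)"
        using assms D by (simp add: powr_mult)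
      moreover have "(c * (real M)\<^sup>2) powr (1 - \<rho>) = c powr (1 - \<rho>) * real M powr (2 * (1 - \<rho>))"
        unfolding sq using assms by (simp only: powr_mult powr_powr)
      ultimately show ?thesis by (simp only: mult_ac)
    qed
    also have "\<dots> = D powr \<rho> * c * real M powr (2 - \<rho>)"
      using assms by (simp add: algebra_simps flip: powr_add)
    also have "\<dots> \<le> D * c * real M powr (2 - \<rho>)"
      using assms D \<rho> powr_mono[of \<rho> 1 D] by (intro mult_right_mono) auto
    finally show "(c * (D * real M)) powr recip p * (c * (real M)\<^sup>2) powr (1 - recip p)
        \<le> D * c * real M powr (2 - recip p)"
      by (simp add: \<rho>_def)
  qed
  finally show ?thesis using assms by (simp add: norm_mult D_def)
qed

lemma eLp_norm_bump_ge:
  fixes e :: "'d::finite"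
  assumes "2 < q" "0 < c" "0 < M"
  shows "ennreal (c * real M powr (2 - 1 / q) / 4)
           \<le> eLp_norm (ennreal q) torus (\<lambda>x. ennreal (cmod (complex_of_real c * bump e K M x)))"
proof -
  define D where "D = (2 * pi) ^ CARD('d)"
  have sq: "(real M)\<^sup>2 = real M powr 2" using assms by simp
  have "1 \<le> 2 * pi" using pi_gt3 by linarith
  then have D: "1 \<le> D" unfolding D_def by (rule one_le_power)
  \<comment> \<open>With this threshold, \<open>T\<close> times the \<open>L\<^sub>1\<close> norm is
    D * c^2 * M^3 / 4, half of the lower bound for the squared \<open>L\<^sub>2\<close> norm, so the
    other half survives.\<close>
  define T where "T = c * (real M)\<^sup>2 / 4"
  have T: "0 < T" using assms by (simp add: T_def)
  have "ennreal (c * real M powr (2 - 1 / q) / 4) \<le> eLp_norm (ennreal q) torus (\<lambda>x. ennreal (c * cmod (bump e K M x)))"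
  proof (rule eLp_norm_ge_interpolation)
    show "integrable torus (\<lambda>x. c * cmod (bump e K M x))"
      by (intro integrable_mult_right integrable_torus_bounded[where B = "(real M)\<^sup>2"])
         (auto simp: cmod_bump_le)
    show "integrable torus (\<lambda>x. (c * cmod (bump e K M x))\<^sup>2)"
      unfolding power_mult_distrib
      using power_mono[OF cmod_bump_le[of e K M] norm_ge_zero, of _ 2]
      by (intro integrable_mult_right integrable_torus_bounded[where B = "((real M)\<^sup>2)\<^sup>2"])
         (auto simp: norm_power)
    have "(c * real M powr (2 - 1 / q) / 4) powr q = c powr q * real M powr (2 * q - 1) / 4 powr q"
      using assms by (simp add: powr_mult powr_divide powr_powr left_diff_distrib)
    also have "\<dots> \<le> T powr (q - 2) * (c\<^sup>2 * (real M ^ 3 / 4))"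
    proof -
      have "T powr (q - 2) = c powr (q - 2) * real M powr (2 * (q - 2)) / 4 powr (q - 2)"
        unfolding T_def sq using assms by (simp only: powr_mult powr_divide powr_powr)
      moreover have "2 * (q - 2) = 2 * q - 4" by simp
      ultimately have "T powr (q - 2) = c powr (q - 2) * real M powr (2 * q - 4) / 4 powr (q - 2)"
        by (simp only:)
      then have "T powr (q - 2) * (c\<^sup>2 * (real M ^ 3 / 4))
          = (c powr (q - 2) * c powr 2) * (real M powr (2 * q - 4) * real M powr 3) / (4 powr (q - 2) * 4 powr 1)"
        using assms by (simp add: powr_numeral)
      also have "\<dots> = c powr q * real M powr (2 * q - 1) / 4 powr (q - 1)"
        by (simp only: powr_add[symmetric]) simp
      also have "\<dots> \<ge> c powr q * real M powr (2 * q - 1) / 4 powr q"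
        by (intro divide_left_mono) (auto intro: powr_mono)
      finally show ?thesis .
    qed
    also have "\<dots> \<le> T powr (q - 2) * (c\<^sup>2 * (D * (real M ^ 3 / 2)) - T * (c * (D * real M)))"
    proof (rule mult_left_mono)
      have "c\<^sup>2 * (D * (real M ^ 3 / 2)) - T * (c * (D * real M)) = D * (c\<^sup>2 * (real M ^ 3 / 4))"
        by (simp add: T_def power2_eq_square power3_eq_cube algebra_simps)
      also have "\<dots> \<ge> 1 * (c\<^sup>2 * (real M ^ 3 / 4))"
        using D by (intro mult_right_mono) auto
      finally show "c\<^sup>2 * (real M ^ 3 / 4) \<le> c\<^sup>2 * (D * (real M ^ 3 / 2)) - T * (c * (D * real M))" by simp
    qed simp
    also have "\<dots> \<le> T powr (q - 2) * ((LINT x|torus. (c * cmod (bump e K M x))\<^sup>2)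
        - T * (LINT x|torus. c * cmod (bump e K M x)))"
    proof (intro mult_left_mono diff_mono)
      show "c\<^sup>2 * (D * (real M ^ 3 / 2)) \<le> (LINT x|torus. (c * cmod (bump e K M x))\<^sup>2)"
        using mult_left_mono[OF integral_cmod_bump_square[of M e K], of "c\<^sup>2"]
        by (simp add: power_mult_distrib D_def)
      show "(LINT x|torus. c * cmod (bump e K M x)) \<le> c * (D * real M)"
        by (simp add: integral_cmod_bump D_def)
    qed (use T in auto)
    finally show "(c * real M powr (2 - 1 / q) / 4) powr q
        \<le> T powr (q - 2) * ((LINT x|torus. (c * cmod (bump e K M x))\<^sup>2)
        - T * (LINT x|torus. c * cmod (bump e K M x)))" .
  qed (use assms T in auto)
  then show ?thesis using assms by (simp add: norm_mult)
qed

section \<open>Fourier coefficients and dyadic blocks\<close>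

lemma cutoff_eq_1: "cutoff \<eta> \<Longrightarrow> -1 \<le> t \<Longrightarrow> t \<le> 1 \<Longrightarrow> \<eta> t = 1"
  by (simp add: cutoff_def)

lemma cutoff_eq_0: "cutoff \<eta> \<Longrightarrow> 3 / 2 < t \<Longrightarrow> \<eta> t = 0"
  by (simp add: cutoff_def)

lemma dyadic_0: "cutoff \<eta> \<Longrightarrow> dyadic \<eta> k 0 = of_bool (k = 0)"
  by (simp add: dyadic_def cutoff_eq_1)

text \<open>On this range of \<open>t\<close>, the value \<eta>(t / 2^j) is 0 for j < K, because t /
  2^j > 3/2, and 1 for j \<ge> K. Only the difference at k = K sees the jump.\<close>

lemma dyadic_plateau:
  assumes \<eta>: "cutoff \<eta>" and t: "3 * 2 ^ K < 4 * t" "t \<le> 2 ^ K"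
  shows "dyadic \<eta> k t = of_bool (k = K)"
proof -
  have "(0::real) < 2 ^ K" by simp
  then have "0 < t" using t(1) by linarith
  have one: "\<eta> (t / 2 ^ j) = 1" if "K \<le> j" for j
  proof -
    have "t \<le> 2 ^ j"
      using t(2) that by (meson order_trans power_increasing one_le_numeral)
    then show ?thesis using \<open>0 < t\<close> \<eta> by (intro cutoff_eq_1) (auto simp: field_simps intro: order_trans[of _ 0])
  qed
  have zero: "\<eta> (t / 2 ^ j) = 0" if "j < K" for j
  proof -
    have "(2::real) ^ Suc j \<le> 2 ^ K"
      using that by (intro power_increasing) auto
    then show ?thesis using t(1) \<eta> by (intro cutoff_eq_0) (auto simp: field_simps)
  qed
  \<comment> \<open>The case k = 0 is separate because \<open>dyadic\<close> subtracts nothing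
    there; for k > 0 the indices k - 1 and k lie on different sides of the jump only if k =
    K.\<close>
  have "k = 0 \<or> (0 < k \<and> k < K) \<or> (0 < k \<and> k = K) \<or> (0 < k \<and> K < k)" by auto
  then show ?thesis
    by (elim disjE) (use zero[of k] zero[of "k - 1"] one[of k] one[of "k - 1"] zero[of 0] one[of 0]
      in \<open>auto simp: dyadic_def\<close>)
qed

text \<open>All coordinates other than \<open>e\<close> have frequency 0, which only the index 0
  detects; the coordinate \<open>e\<close> is handled by the plateau.\<close>

lemma dyadic_prod_axis:
  fixes e :: "'d::finite"
  assumes \<eta>: "cutoff \<eta>" and f: "3 * 2 ^ K < 4 * f" "f \<le> 2 ^ K"
  shows "dyadic_prod \<eta> m (\<chi> i. real_of_int (axis e f $ i)) = of_bool (m = axis e K)"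
proof -
  have "real_of_int (3 * 2 ^ K) < real_of_int (4 * f)" "real_of_int f \<le> real_of_int (2 ^ K)"
    using f by (simp_all only: of_int_less_iff of_int_le_iff)
  then have *: "dyadic \<eta> k (real_of_int f) = of_bool (k = K)" for k
    by (intro dyadic_plateau[OF \<eta>]) auto
  have "dyadic_prod \<eta> m (\<chi> i. real_of_int (axis e f $ i)) = (\<Prod>i\<in>UNIV. of_bool (m $ i = axis e K $ i))"
    unfolding dyadic_prod_def
    by (intro prod.cong refl) (auto simp: axis_def * dyadic_0[OF \<eta>])
  also have "\<dots> = of_bool (m = axis e K)"
    by (auto simp: vec_eq_iff of_bool_def intro: prod_zero)
  finally show ?thesis .
qed

section \<open>Fourier coefficients of sums and series\<close>

lemma integrable_mult_cnj_trig:
  fixes f :: "real ^ 'd \<Rightarrow> complex"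
  assumes "integrable torus f"
  shows "integrable torus (\<lambda>x. f x * cnj (trig k x))"
proof (rule Bochner_Integration.integrable_bound[OF assms])
  show "(\<lambda>x. f x * cnj (trig k x)) \<in> borel_measurable torus"
  proof -
    have "(\<lambda>x::real^'d. cnj (trig k x)) \<in> borel_measurable borel"
      unfolding trig_def by (intro borel_measurable_continuous_onI continuous_intros)
    then show ?thesis
      using assms borel_measurable_torus by (intro borel_measurable_times) auto
  qed
qed (simp add: norm_mult)

lemma fourier_coeff_add:
  assumes "integrable torus f" "integrable torus g"
  shows "fourier_coeff (\<lambda>x. f x + g x) k = fourier_coeff f k + fourier_coeff g k"
  unfolding fourier_coeff_def
  using assms by (simp add: distrib_right integrable_mult_cnj_trig add_divide_distrib)

lemma fourier_coeff_cmult: "fourier_coeff (\<lambda>x. c * f x) k = c * fourier_coeff f k"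
  unfolding fourier_coeff_def by (simp add: mult.assoc) 

lemma fourier_coeff_sum_trig:
  assumes "finite A"
  shows "fourier_coeff (\<lambda>x. \<Sum>a\<in>A. trig (\<kappa> a) x) k = (\<Sum>a\<in>A. of_bool (\<kappa> a = k))"
  using assms
proof (induction A rule: finite_induct)
  case empty
  then show ?case by (simp add: fourier_coeff_def)
next
  case (insert a A)
  then show ?case
    by (simp add: fourier_coeff_add integrable_trig_torus fourier_coeff_trig)
qed

text \<open>Summable \<open>L\<^sub>1\<close> norms give absolute convergence almost everywhere and
  justify integrating term by term. The factor \<open>cnj (trig k x)\<close> has modulus 1 and
  leaves these norms unchanged.\<close>

lemma fourier_coeff_suminf:
  fixes f :: "nat \<Rightarrow> real ^ 'd \<Rightarrow> complex"
  assumes int: "\<And>n. integrable torus (f n)"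
    and sum: "summable (\<lambda>n. LINT x|torus. cmod (f n x))"
  shows "integrable torus (\<lambda>x. \<Sum>n. f n x)"
    and "fourier_coeff (\<lambda>x. \<Sum>n. f n x) k = (\<Sum>n. fourier_coeff (f n) k)"
      and "summable (\<lambda>n. fourier_coeff (f n) k)"
proof -
  have [measurable]: "f n \<in> borel_measurable torus" for n
    using int by auto
  have "(\<integral>\<^sup>+x. (\<Sum>n. ennreal (cmod (f n x))) \<partial>torus) = (\<Sum>n. ennreal (LINT x|torus. cmod (f n x)))"
    using int by (subst nn_integral_suminf) (auto simp: nn_integral_eq_integral)
  also have "\<dots> \<noteq> \<infinity>"
    using sum by (simp add: suminf_ennreal2)
  finally have "AE x in torus. (\<Sum>n. ennreal (cmod (f n x))) \<noteq> \<infinity>"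
    by (intro nn_integral_PInf_AE) auto
  then have AE: "AE x in torus. summable (\<lambda>n. cmod (f n x))"
    by eventually_elim (auto intro: summable_suminf_not_top)
  show "integrable torus (\<lambda>x. \<Sum>n. f n x)"
    using int AE sum by (rule integrable_suminf)
  define g where "g n x = f n x * cnj (trig k x)" for n x
  have g: "integrable torus (g n)" for n
    unfolding g_def using int by (rule integrable_mult_cnj_trig)
  have cg: "cmod (g n x) = cmod (f n x)" for n x by (simp add: g_def norm_mult)
  have gs: "(\<lambda>n. LINT x|torus. g n x) sums (LINT x|torus. (\<Sum>n. g n x))"
    using g AE sum by (intro sums_integral) (auto simp: cg)
  have "(LINT x|torus. (\<Sum>n. f n x) * cnj (trig k x)) = (LINT x|torus. (\<Sum>n. g n x))"
  proof (rule integral_cong_AE)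
    show "AE x in torus. (\<Sum>n. f n x) * cnj (trig k x) = (\<Sum>n. g n x)"
      using AE by eventually_elim (simp add: g_def suminf_mult2 summable_norm_cancel)
    show "(\<lambda>x. \<Sum>n. g n x) \<in> borel_measurable torus"
      using g by (intro borel_measurable_suminf) auto
    show "(\<lambda>x. (\<Sum>n. f n x) * cnj (trig k x)) \<in> borel_measurable torus"
      using integrable_mult_cnj_trig[OF \<open>integrable torus (\<lambda>x. \<Sum>n. f n x)\<close>] by auto
  qed
  then have "(\<lambda>n. fourier_coeff (f n) k) sums fourier_coeff (\<lambda>x. \<Sum>n. f n x) k"
    using sums_mult[OF gs] unfolding fourier_coeff_def g_def by (simp only:)
  then show "fourier_coeff (\<lambda>x. \<Sum>n. f n x) k = (\<Sum>n. fourier_coeff (f n) k)"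
    "summable (\<lambda>n. fourier_coeff (f n) k)"
    by (auto simp: sums_iff)
qed

text \<open>Resums a trigonometric polynomial from its coefficients. Distinct \<open>a\<close> may
  share a frequency, so the sum runs over the image of \<open>\<kappa>\<close> before the order of
  summation is swapped.\<close>

lemma infsum_trig:
  assumes "finite A"
  shows "(\<Sum>\<^sub>\<infinity>k. (\<Sum>a\<in>A. of_bool (\<kappa> a = k)) * trig k z) = (\<Sum>a\<in>A. trig (\<kappa> a) z)"
proof -
  have "(\<Sum>\<^sub>\<infinity>k. (\<Sum>a\<in>A. of_bool (\<kappa> a = k)) * trig k z)
      = (\<Sum>\<^sub>\<infinity>k\<in>\<kappa> ` A. (\<Sum>a\<in>A. of_bool (\<kappa> a = k)) * trig k z)"
    by (rule infsum_cong_neutral) (auto intro!: sum.neutral)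
  also have "\<dots> = (\<Sum>k\<in>\<kappa> ` A. \<Sum>a\<in>A. of_bool (\<kappa> a = k) * trig k z)"
    using assms by (simp add: sum_distrib_right)
  also have "\<dots> = (\<Sum>a\<in>A. \<Sum>k\<in>\<kappa> ` A. of_bool (\<kappa> a = k) * trig k z)"
    by (rule sum.swap)
  also have "\<dots> = (\<Sum>a\<in>A. trig (\<kappa> a) z)"
  proof (rule sum.cong[OF refl])
    fix a assume "a \<in> A"
    then have "(\<Sum>k\<in>\<kappa> ` A. of_bool (\<kappa> a = k) * trig k z) = (\<Sum>k\<in>\<kappa> ` A. if k = \<kappa> a then trig k z else 0)"
      by (intro sum.cong) auto
    then show "(\<Sum>k\<in>\<kappa> ` A. of_bool (\<kappa> a = k) * trig k z) = trig (\<kappa> a) z"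
      using assms \<open>a \<in> A\<close> by simp
  qed
  finally show ?thesis .
qed

section \<open>Dyadic blocks as finite sums: measurability and additivity\<close>

lemma dyadic_support:
  assumes "cutoff \<eta>" "dyadic \<eta> k t \<noteq> 0"
  shows "\<bar>t\<bar> \<le> 3 / 2 * 2 ^ k"
proof -
  have supp: "\<bar>t\<bar> \<le> 3 / 2 * 2 ^ j" if "\<eta> (t / 2 ^ j) \<noteq> 0" for j
  proof -
    have "t / 2 ^ j \<in> {-3/2..3/2}"
      using assms(1) that unfolding cutoff_def by blast
    then show ?thesis by (auto simp: field_simps abs_le_iff)
  qed
  consider "\<eta> (t / 2 ^ k) \<noteq> 0" | "\<eta> (t / 2 ^ (k - 1)) \<noteq> 0"
    using assms(2) by (cases "\<eta> (t / 2 ^ k) = 0") (simp_all add: dyadic_def split: if_splits)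
  then show ?thesis
  proof cases
    case 2
    have "(2::real) ^ (k - 1) \<le> 2 ^ k" by (intro power_increasing) auto
    then show ?thesis using supp[OF 2] by linarith
  qed (rule supp)
qed

lemma finite_vec_box:
  fixes S :: "'d::finite \<Rightarrow> 'a set"
  assumes "\<And>i. finite (S i)"
  shows "finite {k :: 'a ^ 'd. \<forall>i. k $ i \<in> S i}"
proof (rule finite_subset)
  show "{k. \<forall>i. k $ i \<in> S i} \<subseteq> vec_lambda ` (Pi\<^sub>E UNIV S)"
  proof
    fix k :: "'a ^ 'd" assume "k \<in> {k. \<forall>i. k $ i \<in> S i}"
    then show "k \<in> vec_lambda ` (Pi\<^sub>E UNIV S)"
      by (intro image_eqI[of _ _ "vec_nth k"]) auto
  qed
  show "finite (vec_lambda ` (Pi\<^sub>E UNIV S) :: ('a ^ 'd) set)"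
    using assms by (intro finite_imageI finite_PiE) auto
qed

text \<open>The finite set depends on \<open>m\<close> but not on the function, so blocks of
  different functions can be added over the same index set.\<close>

lemma dyadic_block_finite_sum:
  fixes m :: "nat ^ 'd::finite"
  assumes "cutoff \<eta>"
  shows "\<exists>S. finite S \<and> (\<forall>f x. dyadic_block \<eta> m f x =
       (\<Sum>k\<in>S. complex_of_real (dyadic_prod \<eta> m (\<chi> i. real_of_int (k $ i))) * fourier_coeff f k * trig k x))"
proof (intro exI conjI allI)
  \<comment> \<open>The support radius 3/2 * 2^m is rounded up to 2 * 2^m to have an integer bound
    for every \<open>m\<close>.\<close>
  define S where "S = {k :: int ^ 'd. \<forall>i. k $ i \<in> {- (2 * 2 ^ (m $ i))..2 * 2 ^ (m $ i)}}"
  show fin: "finite S" unfolding S_def by (rule finite_vec_box) simp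
  have "k \<in> S" if "dyadic_prod \<eta> m (\<chi> i. real_of_int (k $ i)) \<noteq> 0" for k
  proof -
    have "\<bar>real_of_int (k $ i)\<bar> \<le> real_of_int (2 * 2 ^ (m $ i))" for i
    proof -
      have "\<bar>real_of_int (k $ i)\<bar> \<le> 3 / 2 * 2 ^ (m $ i)"
        using that by (intro dyadic_support[OF assms]) (auto simp: dyadic_prod_def)
      also have "\<dots> \<le> 2 * 2 ^ (m $ i)" by simp
      finally show ?thesis by simp
    qed
    then have "\<bar>k $ i\<bar> \<le> 2 * 2 ^ (m $ i)" for i
      by (simp only: of_int_le_iff flip: of_int_abs)
    then show ?thesis by (auto simp: S_def abs_le_iff minus_le_iff)
  qed
  then have "dyadic_block \<eta> m f x =
       (\<Sum>\<^sub>\<infinity>k\<in>S. complex_of_real (dyadic_prod \<eta> m (\<chi> i. real_of_int (k $ i))) * fourier_coeff f k * trig k x)" for f x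
    unfolding dyadic_block_def by (intro infsum_cong_neutral) auto
  then show "dyadic_block \<eta> m f x =
       (\<Sum>k\<in>S. complex_of_real (dyadic_prod \<eta> m (\<chi> i. real_of_int (k $ i))) * fourier_coeff f k * trig k x)" for f x
    using fin by simp
qed

lemma borel_measurable_dyadic_block:
  assumes "cutoff \<eta>"
  shows "dyadic_block \<eta> m f \<in> borel_measurable borel"
proof -
  obtain S where "finite S" and S: "\<And>f x. dyadic_block \<eta> m f x =
      (\<Sum>k\<in>S. complex_of_real (dyadic_prod \<eta> m (\<chi> i. real_of_int (k $ i))) * fourier_coeff f k * trig k x)"
    using dyadic_block_finite_sum[OF assms, of m] by blast
  from S have "dyadic_block \<eta> m f = (\<lambda>x. \<Sum>k\<in>S. complex_of_real
      (dyadic_prod \<eta> m (\<chi> i. real_of_int (k $ i))) * fourier_coeff f k * trig k x)"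
    by (intro ext)
  then show ?thesis
    by (auto intro!: borel_measurable_sum borel_measurable_times)
qed

lemma dyadic_block_add:
  assumes "cutoff \<eta>" "integrable torus f" "integrable torus g"
  shows "dyadic_block \<eta> m (\<lambda>x. f x + g x) z = dyadic_block \<eta> m f z + dyadic_block \<eta> m g z"
proof -
  obtain S where "finite S" and S: "\<And>f x. dyadic_block \<eta> m f x =
      (\<Sum>k\<in>S. complex_of_real (dyadic_prod \<eta> m (\<chi> i. real_of_int (k $ i))) * fourier_coeff f k * trig k x)"
    using dyadic_block_finite_sum[OF assms(1), of m] by blast
  show ?thesis
    unfolding S using assms by (simp add: fourier_coeff_add algebra_simps sum.distrib)
qed

lemma inner_axis_const:
  "(\<chi> i. real (axis e K $ i)) \<bullet> (\<chi> i. r) = real K * r"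
  for e :: "'d::finite"
proof -
  have "(\<chi> i. real (axis e K $ i)) \<bullet> (\<chi> i. r) = (\<Sum>i\<in>UNIV. if i = e then real K * r else 0)"
    unfolding inner_vec_def by (intro sum.cong) (auto simp: axis_def)
  then show ?thesis by simp
qed

lemma eLp_norm_0:
  assumes "1 \<le> p"
  shows "eLp_norm p M (\<lambda>x. 0) = 0"
  using assms
proof (cases rule: ennreal_exponent_cases)
  case top
  have "esssup M (\<lambda>x. 0 :: ennreal) \<le> 0" by (intro esssup_I) auto
  then show ?thesis using top by (simp add: eLp_norm_def)
next
  case (real P)
  then show ?thesis using eLp_norm_le_iff[of P 0 M "\<lambda>x. 0"] by (simp add: enn_powr_def)
qed

text \<open>Holds at every point: where the series fails to converge absolutely, the right-hand side
  is infinite.\<close>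

lemma ennreal_norm_suminf_le:
  fixes f :: "nat \<Rightarrow> complex"
  shows "ennreal (norm (\<Sum>n. f n)) \<le> (\<Sum>n. ennreal (norm (f n)))"
proof (cases "(\<Sum>n. ennreal (norm (f n))) = top")
  case False
  then have "summable (\<lambda>n. norm (f n))"
    by (intro summable_suminf_not_top) auto
  then show ?thesis
    by (simp add: suminf_ennreal2 ennreal_leI summable_norm)
qed simp

section \<open>Lacunary series of kernels\<close>

text \<open>The bound \<open>M_le\<close> puts the spectrum on the plateau: with K = K0 + n, the
  frequencies exceed 2^K - 2M \<ge> 3/4 * 2^K. The last assumption is \<open>L\<^sub>1\<close>
  convergence, up to the volume factor. The shift \<open>K0\<close> leaves room for
  \<open>M_le\<close> to hold from the first term on.\<close>

locale bump_series =
  fixes \<eta> :: "real \<Rightarrow> real" and e :: "'d::finite" and K0 :: nat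
    and M :: "nat \<Rightarrow> nat" and c :: "nat \<Rightarrow> real"
  assumes cutoff: "cutoff \<eta>"
    and M_pos: "0 < M n" and M_le: "8 * M n \<le> 2 ^ (K0 + n)"
    and c_pos: "0 < c n"
    and summable: "summable (\<lambda>n. c n * real (M n))"
begin

definition summand :: "nat \<Rightarrow> real ^ 'd \<Rightarrow> complex" where
  "summand n x = complex_of_real (c n) * bump e (K0 + n) (M n) x"

definition series :: "real ^ 'd \<Rightarrow> complex" where
  "series x = (\<Sum>n. summand n x)"

lemma borel_measurable_summand [measurable]: "summand n \<in> borel_measurable borel"
  unfolding summand_def by measurable

lemma borel_measurable_series [measurable]: "series \<in> borel_measurable borel"
  unfolding series_def by measurable

lemma integrable_summand: "integrable torus (summand n)"
  unfolding summand_def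
  by (intro integrable_mult_right integrable_torus_bounded[where B = "(real (M n))\<^sup>2"])
     (auto simp: cmod_bump_le)

lemma summable_integral_summand: "summable (\<lambda>n. LINT x|torus. cmod (summand n x))"
proof -
  have "(LINT x|torus. cmod (summand n x)) = (2 * pi) ^ CARD('d) * (c n * real (M n))" for n
    using c_pos[of n] by (simp add: summand_def norm_mult integral_cmod_bump)
  then show ?thesis using summable by (simp only: summable_mult)
qed

lemma fourier_coeff_series:
  "(\<lambda>n. fourier_coeff (summand n) k) sums fourier_coeff series k"
  using fourier_coeff_suminf(2,3)[OF integrable_summand summable_integral_summand]
  by (simp add: series_def[abs_def] sums_iff)

definition freq :: "nat \<Rightarrow> nat \<times> nat \<Rightarrow> int ^ 'd" where
  "freq n a = axis e (2 ^ (K0 + n) - int (fst a) - int (snd a))"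

lemma summand_eq: "summand n x = complex_of_real (c n) * (\<Sum>a\<in>{..<M n} \<times> {..<M n}. trig (freq n a) x)"
  by (simp add: summand_def bump_def freq_def)

lemma fourier_coeff_summand:
  "fourier_coeff (summand n) k = complex_of_real (c n) * (\<Sum>a\<in>{..<M n} \<times> {..<M n}. of_bool (freq n a = k))"
  unfolding summand_eq[abs_def] fourier_coeff_cmult by (subst fourier_coeff_sum_trig) auto

lemma dyadic_prod_freq:
  assumes "a \<in> {..<M n} \<times> {..<M n}"
  shows "dyadic_prod \<eta> m (\<chi> i. real_of_int (freq n a $ i)) = of_bool (m = axis e (K0 + n))"
proof -
  have "int (8 * M n) \<le> int (2 ^ (K0 + n))"
    using M_le by (simp only: of_nat_le_iff)
  then show ?thesis
    unfolding freq_def using assms by (intro dyadic_prod_axis[OF cutoff]) auto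
qed

text \<open>The cutoff need only be known where the coefficient is nonzero, that is at the
  frequencies of the kernel, and there it is 0 or 1.\<close>

lemma dyadic_prod_summand:
  "complex_of_real (dyadic_prod \<eta> m (\<chi> i. real_of_int (k $ i))) * fourier_coeff (summand n) k
     = of_bool (m = axis e (K0 + n)) * fourier_coeff (summand n) k"
proof (cases "\<exists>a\<in>{..<M n} \<times> {..<M n}. freq n a = k")
  case True
  then show ?thesis using dyadic_prod_freq by auto
next
  case False
  then have "fourier_coeff (summand n) k = 0"
    unfolding fourier_coeff_summand by (auto intro!: sum.neutral)
  then show ?thesis by simp
qed

text \<open>Multiplying the series of coefficients by the cutoff kills every term except the
  \<open>n\<close>-th, as different summands belong to different blocks.\<close>

lemma dyadic_block_series:
  "dyadic_block \<eta> (axis e (K0 + n)) series = summand n"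
proof
  fix z
  have "complex_of_real (dyadic_prod \<eta> (axis e (K0 + n)) (\<chi> i. real_of_int (k $ i))) * fourier_coeff series k
      = fourier_coeff (summand n) k" for k
  proof -
    have "(\<lambda>j. if j = n then fourier_coeff (summand j) k else 0) sums
        (complex_of_real (dyadic_prod \<eta> (axis e (K0 + n)) (\<chi> i. real_of_int (k $ i))) * fourier_coeff series k)"
      using sums_mult[OF fourier_coeff_series, of "complex_of_real (dyadic_prod \<eta> (axis e (K0 + n)) (\<chi> i. real_of_int (k $ i)))" k]
      unfolding dyadic_prod_summand by (rule sums_cong[THEN iffD1, rotated]) (auto simp: axis_eq_axis)
    then show ?thesis
      by (rule sums_unique2[OF _ sums_single])
  qed
  then have "dyadic_block \<eta> (axis e (K0 + n)) series z = (\<Sum>\<^sub>\<infinity>k. fourier_coeff (summand n) k * trig k z)"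
    unfolding dyadic_block_def by simp
  also have "\<dots> = complex_of_real (c n) * (\<Sum>\<^sub>\<infinity>k. (\<Sum>a\<in>{..<M n} \<times> {..<M n}. of_bool (freq n a = k)) * trig k z)"
    unfolding fourier_coeff_summand mult.assoc by (rule infsum_cmult_right')
  also have "\<dots> = summand n z"
    by (simp only: infsum_trig finite_lessThan finite_cartesian_product summand_eq)
  finally show "dyadic_block \<eta> (axis e (K0 + n)) series z = summand n z" .
qed

lemma dyadic_block_series_eq_0:
  assumes "m \<notin> range (\<lambda>n. axis e (K0 + n))"
  shows "dyadic_block \<eta> m series = (\<lambda>x. 0)"
proof
  fix z
  have "complex_of_real (dyadic_prod \<eta> m (\<chi> i. real_of_int (k $ i))) * fourier_coeff series k = 0" for k
  proof -
    have "(\<lambda>j. 0) sums (complex_of_real (dyadic_prod \<eta> m (\<chi> i. real_of_int (k $ i))) * fourier_coeff series k)"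
      using sums_mult[OF fourier_coeff_series, of "complex_of_real (dyadic_prod \<eta> m (\<chi> i. real_of_int (k $ i)))" k]
      unfolding dyadic_prod_summand by (rule sums_cong[THEN iffD1, rotated]) (use assms in auto)
    then show ?thesis using sums_unique2 sums_zero by blast
  qed
  then show "dyadic_block \<eta> m series z = 0"
    unfolding dyadic_block_def by (intro infsum_0) simp
qed

text \<open>The terms (1 - \<rho>) * \<rho>^n add up to 1, so the weighted block norms have
  \<open>l\<^sub>1\<close> norm at most 1. As r \<ge> 0 the weights are at least 1, and the same
  bound yields convergence in \<open>L\<^sub>p\<close>.\<close>

lemma series_in_besov_ball:
  assumes "1 \<le> p" "1 \<le> \<theta>" "0 \<le> r" "0 < \<rho>" "\<rho> < 1"
    and le: "\<And>n. 2 powr (real (K0 + n) * r) * ((2 * pi) ^ CARD('d) * c n * real (M n) powr (2 - recip p))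
               \<le> (1 - \<rho>) * \<rho> ^ n"
  shows "series \<in> besov_ball \<eta> (\<chi> i. r) p \<theta>"
proof -
  let ?u = "\<lambda>n. (2 * pi) ^ CARD('d) * c n * real (M n) powr (2 - recip p)"
  have u0: "0 \<le> ?u n" for n using c_pos[of n] by simp
  have eLp: "eLp_norm p torus (\<lambda>x. ennreal (cmod (summand n x))) \<le> ennreal (?u n)" for n
    unfolding summand_def by (intro eLp_norm_bump_le assms c_pos M_pos)
  define a where "a m = ennreal (2 powr ((\<chi> i. real (m $ i)) \<bullet> (\<chi> i. r))) *
      eLp_norm p torus (\<lambda>x. ennreal (cmod (dyadic_block \<eta> m series x)))" for m :: "nat ^ 'd"
  have a_axis: "a (axis e (K0 + n)) \<le> ennreal ((1 - \<rho>) * \<rho> ^ n)" for n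
  proof -
    have "a (axis e (K0 + n)) \<le> ennreal (2 powr (real (K0 + n) * r)) * ennreal (?u n)"
      unfolding a_def inner_axis_const dyadic_block_series by (intro mult_left_mono eLp) simp
    also have "\<dots> = ennreal (2 powr (real (K0 + n) * r) * ?u n)"
      using u0 by (intro ennreal_mult[symmetric]) auto
    also have "\<dots> \<le> ennreal ((1 - \<rho>) * \<rho> ^ n)"
      by (intro ennreal_leI le)
    finally show ?thesis .
  qed
  have "(\<integral>\<^sup>+m. a m \<partial>count_space UNIV) = (\<integral>\<^sup>+m. a m \<partial>count_space (range (\<lambda>n. axis e (K0 + n))))"
    by (rule nn_integral_count_space_eq)
       (auto simp: a_def dyadic_block_series_eq_0 eLp_norm_0 assms)
  also have "\<dots> = (\<integral>\<^sup>+n. a (axis e (K0 + n)) \<partial>count_space UNIV)"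
    by (rule nn_integral_bij_count_space[symmetric]) (auto simp: bij_betw_def inj_on_def axis_eq_axis)
  also have "\<dots> \<le> (\<Sum>n. ennreal ((1 - \<rho>) * \<rho> ^ n))"
    unfolding nn_integral_count_space_nat by (intro suminf_le a_axis) auto
  also have "\<dots> = ennreal ((1 - \<rho>) / (1 - \<rho>))"
    using assms by (intro suminf_geometric_ennreal) auto
  also have "\<dots> = 1" using assms by simp
  finally have norm: "besov_norm \<eta> (\<chi> i. r) p \<theta> series \<le> 1"
    unfolding besov_norm_def a_def[symmetric] by (intro eLp_norm_count_space_le_1 assms)
  have "eLp_norm p torus (\<lambda>x. ennreal (cmod (series x))) \<le> eLp_norm p torus (\<lambda>x. \<Sum>n. ennreal (cmod (summand n x)))"
  proof (rule eLp_norm_mono[OF assms(1)])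
    show "(\<lambda>x. ennreal (cmod (series x))) \<in> borel_measurable torus"
      using borel_measurable_torus[OF borel_measurable_series] by measurable
  qed (simp add: series_def ennreal_norm_suminf_le)
  also have "\<dots> < \<infinity>"
  proof (rule eLp_norm_suminf_finite)
    fix n
    have "?u n \<le> 2 powr (real (K0 + n) * r) * ?u n"
      using u0[of n] assms(3) mult_right_mono[of 1 "2 powr (real (K0 + n) * r)" "?u n"]
      by (simp add: ge_one_powr_ge_zero)
    also have "\<dots> \<le> (1 - \<rho>) * \<rho> ^ n" by (rule le)
    finally show "eLp_norm p torus (\<lambda>x. ennreal (cmod (summand n x))) \<le> ennreal ((1 - \<rho>) * \<rho> ^ n)"
      using eLp[of n] by (meson ennreal_leI order_trans)
    show "(\<lambda>x. ennreal (cmod (summand n x))) \<in> borel_measurable torus"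
      using borel_measurable_torus[OF borel_measurable_summand] by measurable
  qed (use assms in auto)
  finally have "series \<in> Lp_torus p"
    using borel_measurable_torus[OF borel_measurable_series] by (simp add: Lp_torus_def)
  with norm show ?thesis
    by (auto simp: besov_ball_def besov_space_def less_top[symmetric] top_unique)
qed

text \<open>If the difference were in the space, the series would be a sum of two of its elements,
  and its weighted blocks would be uniformly bounded in \<open>L\<^sub>q\<close>. The lower bound
  for the kernels contradicts this.\<close>

lemma series_not_in_besov_space:
  assumes "2 < q" "0 < \<sigma>"
    and unbounded: "\<And>B. \<exists>n. B < 2 powr (real (K0 + n) * l) * (c n * real (M n) powr (2 - 1 / q))"
    and y: "y \<in> besov_space \<eta> (\<chi> i. l) (ennreal q) (ennreal \<sigma>)"
  shows "series - y \<notin> besov_space \<eta> (\<chi> i. l) (ennreal q) (ennreal \<sigma>)"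
proof
  assume "series - y \<in> besov_space \<eta> (\<chi> i. l) (ennreal q) (ennreal \<sigma>)"
  then obtain z where z: "z \<in> besov_space \<eta> (\<chi> i. l) (ennreal q) (ennreal \<sigma>)"
    and series: "series = (\<lambda>x. z x + y x)"
    by (metis (no_types, lifting) diff_add_cancel ext plus_fun_apply)
  have int: "integrable torus f" if "f \<in> besov_space \<eta> (\<chi> i. l) (ennreal q) (ennreal \<sigma>)"
    for f :: "real ^ 'd \<Rightarrow> complex"
    using that assms(1) by (intro Lp_torus_integrable[of q]) (auto simp: besov_space_def)
  define N where "N = max (besov_norm \<eta> (\<chi> i. l) (ennreal q) (ennreal \<sigma>) z) (besov_norm \<eta> (\<chi> i. l) (ennreal q) (ennreal \<sigma>) y)"
  have "N < \<infinity>" using y z by (auto simp: N_def besov_space_def)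
  then obtain A where A: "N = ennreal A" "0 \<le> A" by (cases N) auto
  \<comment> \<open>The factor 16 is the product of the 4 lost in \<open>eLp_norm_bump_ge\<close>
    and the 4 lost in \<open>eLp_norm_add_le\<close>.\<close>
  obtain n where n: "16 * A < 2 powr (real (K0 + n) * l) * (c n * real (M n) powr (2 - 1 / q))"
    using unbounded by blast
  let ?m = "axis e (K0 + n)" and ?w = "2 powr (real (K0 + n) * l)"
  have block: "eLp_norm (ennreal q) torus (\<lambda>x. ennreal (cmod (dyadic_block \<eta> ?m f x))) \<le> ennreal (A / ?w)"
    if "besov_norm \<eta> (\<chi> i. l) (ennreal q) (ennreal \<sigma>) f \<le> N" for f
  proof -
    have "ennreal ?w * eLp_norm (ennreal q) torus (\<lambda>x. ennreal (cmod (dyadic_block \<eta> ?m f x))) \<le> ennreal A"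
      using order_trans[OF le_eLp_norm_count_space[OF assms(2)] that[unfolded besov_norm_def A], of ?m]
      unfolding inner_axis_const .
    then have "ennreal (1 / ?w) * (ennreal ?w * eLp_norm (ennreal q) torus (\<lambda>x. ennreal (cmod (dyadic_block \<eta> ?m f x))))
        \<le> ennreal (1 / ?w) * ennreal A"
      by (rule mult_left_mono) simp
    then show ?thesis
      using A(2) by (simp add: mult.assoc[symmetric] flip: ennreal_mult)
  qed
  have "ennreal (c n * real (M n) powr (2 - 1 / q) / 4) \<le> eLp_norm (ennreal q) torus (\<lambda>x. ennreal (cmod (summand n x)))"
    unfolding summand_def by (intro eLp_norm_bump_ge assms c_pos M_pos)
  also have "\<dots> = eLp_norm (ennreal q) torus (\<lambda>x. ennreal (cmod (dyadic_block \<eta> ?m series x)))"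
    by (simp only: dyadic_block_series)
  also have "\<dots> \<le> ennreal (4 * (A / ?w))"
  proof (rule eLp_norm_add_le)
    show "eLp_norm (ennreal q) torus (\<lambda>x. ennreal (cmod (dyadic_block \<eta> ?m z x))) \<le> ennreal (A / ?w)"
      "eLp_norm (ennreal q) torus (\<lambda>x. ennreal (cmod (dyadic_block \<eta> ?m y x))) \<le> ennreal (A / ?w)"
      by (rule block, simp add: N_def)+
    show "(\<lambda>x. ennreal (cmod (dyadic_block \<eta> ?m z x))) \<in> borel_measurable torus"
      "(\<lambda>x. ennreal (cmod (dyadic_block \<eta> ?m y x))) \<in> borel_measurable torus"
      using borel_measurable_torus[OF borel_measurable_dyadic_block[OF cutoff]] by measurable
    show "ennreal (cmod (dyadic_block \<eta> ?m series x))
        \<le> ennreal (cmod (dyadic_block \<eta> ?m z x)) + ennreal (cmod (dyadic_block \<eta> ?m y x))" for x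
      unfolding series dyadic_block_add[OF cutoff int[OF z] int[OF y]]
      by (simp add: norm_triangle_ineq ennreal_leI flip: ennreal_plus)
  qed (use assms A in auto)
  finally have "c n * real (M n) powr (2 - 1 / q) / 4 \<le> 4 * (A / ?w)"
    using A(2) by (subst (asm) ennreal_le_iff) auto
  then show False using n by (simp add: field_simps)
qed

end

section \<open>Exponents and the width\<close>

lemma exists_between_finite_sets:
  fixes A B :: "real set"
  assumes "finite A" "finite B" "A \<noteq> {}" "B \<noteq> {}" "\<And>a b. a \<in> A \<Longrightarrow> b \<in> B \<Longrightarrow> a < b"
  shows "\<exists>t. (\<forall>a\<in>A. a < t) \<and> (\<forall>b\<in>B. t < b)"
proof -
  have "Max A < Min B" using assms by simp
  then obtain t where "Max A < t" "t < Min B" using dense by blast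
  then show ?thesis using assms by (meson Max_ge Min_le le_less_trans less_le_trans)
qed

text \<open>Here \<open>\<rho> j\<close> stands for 1/p_j and \<open>Q\<close> for 1/q. The kernels
  will have order 2^(tK); \<open>\<delta>\<close> is the decay rate of the block norms in all the
  balls, and \<beta> - t * Q > 0 the growth rate in the target space.\<close>

lemma exists_exponents:
  fixes \<alpha> \<rho> :: "'a \<Rightarrow> real"
  assumes J: "finite J" "J \<noteq> {}" and "Q < 1" and "\<And>j. j \<in> J \<Longrightarrow> \<rho> j \<noteq> Q"
    and neg: "\<And>i. i \<in> J \<Longrightarrow> \<rho> i < Q \<Longrightarrow> \<alpha> i < 0"
    and pos: "\<And>j. j \<in> J \<Longrightarrow> Q < \<rho> j \<Longrightarrow> \<alpha> j < \<rho> j - Q"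
    and pair: "\<And>i j. i \<in> J \<Longrightarrow> j \<in> J \<Longrightarrow> \<rho> i < Q \<Longrightarrow> Q < \<rho> j \<Longrightarrow>
                 \<alpha> j * (Q - \<rho> i) + \<alpha> i * (\<rho> j - Q) < 0"
  obtains t \<beta> \<delta> where "0 < t" "t < 1" "0 < \<delta>" "t * Q < \<beta>"
    "\<And>j. j \<in> J \<Longrightarrow> \<alpha> j + \<beta> - t * \<rho> j \<le> - \<delta>"
proof -
  \<comment> \<open>\<open>A\<close> collects the lower and \<open>B\<close> the upper bounds for
    \<open>t\<close>. The inserted 0 and 1 force 0 < t < 1 and keep both sets nonempty.\<close>
  define A where "A = insert 0 ((\<lambda>j. \<alpha> j / (\<rho> j - Q)) ` {j \<in> J. Q < \<rho> j})"
  define B where "B = insert 1 ((\<lambda>i. - \<alpha> i / (Q - \<rho> i)) ` {i \<in> J. \<rho> i < Q})"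
  have lt: "a < b" if "a \<in> A" "b \<in> B" for a b
  proof -
    from that consider "a = 0" "b = 1"
      | i where "i \<in> J" "\<rho> i < Q" "a = 0" "b = - \<alpha> i / (Q - \<rho> i)"
      | j where "j \<in> J" "Q < \<rho> j" "a = \<alpha> j / (\<rho> j - Q)" "b = 1"
      | i j where "i \<in> J" "\<rho> i < Q" "b = - \<alpha> i / (Q - \<rho> i)" "j \<in> J" "Q < \<rho> j" "a = \<alpha> j / (\<rho> j - Q)"
      by (auto simp: A_def B_def)
    then show ?thesis
    proof cases
      case 2 then show ?thesis using neg by (simp add: divide_neg_pos)
    next
      case 3 then show ?thesis using pos by simp
    next
      case (4 i j)
      then have "\<alpha> j * (Q - \<rho> i) < - \<alpha> i * (\<rho> j - Q)" using pair[of i j] by linarith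
      then show ?thesis using 4 by (simp add: divide_less_eq less_divide_eq) (simp add: field_simps)
    qed simp
  qed
  have "finite A" "finite B" "A \<noteq> {}" "B \<noteq> {}"
    using J by (auto simp: A_def B_def)
  then obtain t where t: "\<And>a. a \<in> A \<Longrightarrow> a < t" "\<And>b. b \<in> B \<Longrightarrow> t < b"
    using lt exists_between_finite_sets[of A B] by blast
  have neg_all: "\<alpha> j - t * (\<rho> j - Q) < 0" if "j \<in> J" for j
  proof (cases "Q < \<rho> j")
    case True
    then have "\<alpha> j / (\<rho> j - Q) < t" using that by (intro t) (auto simp: A_def)
    then show ?thesis using True by (simp add: field_simps)
  next
    case False
    then have lt: "\<rho> j < Q" using assms(4)[OF that] by simp
    then have "t < - \<alpha> j / (Q - \<rho> j)" using that by (intro t) (auto simp: B_def)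
    then show ?thesis using lt by (simp add: field_simps)
  qed
  \<comment> \<open>The negative number \<mu> is the worst of the finitely many strict inequalities.
    Its slack is shared equally: half becomes the decay \<delta>, half the growth \<beta> - t *
    Q.\<close>
  define \<mu> where "\<mu> = Max ((\<lambda>j. \<alpha> j - t * (\<rho> j - Q)) ` J)"
  have "\<mu> < 0" unfolding \<mu>_def using J neg_all by simp
  have le: "\<alpha> j - t * (\<rho> j - Q) \<le> \<mu>" if "j \<in> J" for j
    unfolding \<mu>_def using J that by simp
  show ?thesis
  proof (rule that[of t "- \<mu> / 2" "t * Q - \<mu> / 2"])
    show "\<alpha> j + (t * Q - \<mu> / 2) - t * \<rho> j \<le> - (- \<mu> / 2)" if "j \<in> J" for j
      using le[OF that] by (simp add: algebra_simps)
  qed (use \<open>\<mu> < 0\<close> t in \<open>auto simp: A_def B_def\<close>)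
qed

section \<open>A function in all the balls but outside the target space\<close>

lemma recip_less:
  assumes "0 < q" "ennreal q < p"
  shows "recip p < 1 / q"
  using assms by (cases p) (auto simp: recip_ennreal ennreal_less_iff field_simps)

lemma less_recip:
  assumes "1 \<le> p" "p < ennreal q"
  shows "1 / q < recip p"
  using assms(1)
proof (cases rule: ennreal_exponent_cases)
  case (real P)
  then have "P < q" using assms(2) by (simp add: ennreal_less_iff)
  then show ?thesis using real by (simp add: recip_ennreal field_simps)
qed (use assms in simp)

lemma exists_function_outside:
  fixes p :: "'a \<Rightarrow> ennreal" and r :: "'a \<Rightarrow> real"
  assumes cutoff: "cutoff \<eta>" and "J \<noteq> {}" "2 < q" "0 < \<sigma>"
    and t: "0 < t" "t < 1" and "0 < \<delta>" and \<beta>: "t * (1 / q) < \<beta>"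
    and J: "\<And>j. j \<in> J \<Longrightarrow> 1 \<le> p j" "\<And>j. j \<in> J \<Longrightarrow> 0 < r j"
      "\<And>j. j \<in> J \<Longrightarrow> r j - l + \<beta> - t * recip (p j) \<le> - \<delta>"
  shows "\<exists>f. (\<forall>j\<in>J. \<forall>\<theta>\<ge>1. f \<in> besov_ball \<eta> (\<chi> i::'d::finite. r j) (p j) \<theta>) \<and>
           (\<forall>y \<in> besov_space \<eta> (\<chi> i. l) (ennreal q) (ennreal \<sigma>).
              f - y \<notin> besov_space \<eta> (\<chi> i. l) (ennreal q) (ennreal \<sigma>))"
proof -
  \<comment> \<open>Chosen so that coefficients 2^(\<kappa>K) and kernels of order 2^(tK) give
    weighted block norms of order 2^(K(\<alpha>_j + \<beta> - t/p_j)), with \<alpha>_j = r_j - l, in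
    the \<open>j\<close>-th ball and 2^(K(\<beta> - t/q)) in the target.\<close>
  define \<kappa> where "\<kappa> = \<beta> - 2 * t - l"
  define \<rho> where "\<rho> = 2 powr (- \<delta>)"
  have \<rho>: "0 < \<rho>" "\<rho> < 1" using \<open>0 < \<delta>\<close> by (auto simp: \<rho>_def powr_less_one)
  define D where "D = (2 * pi) ^ CARD('d)"
  have "1 \<le> 2 * pi" using pi_gt3 by linarith
  then have D: "1 \<le> D" unfolding D_def by (rule one_le_power)
  \<comment> \<open>Scales the function into the unit balls: it cancels the volume factor
    \<open>D\<close> and supplies the 1 - \<rho> that normalizes the geometric series.\<close>
  define \<epsilon> where "\<epsilon> = (1 - \<rho>) / D"
  have \<epsilon>: "0 < \<epsilon>" "D * \<epsilon> = 1 - \<rho>" using D \<rho> by (auto simp: \<epsilon>_def)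
  \<comment> \<open>For K \<ge> K0 this gives 3 + t * K \<le> K, which is the spectral condition 8 *
    2^(tK) \<le> 2^K.\<close>
  obtain K0 :: nat where K0: "3 / (1 - t) < real K0"
    using reals_Archimedean2 by blast
  define X where "X n = 2 powr (t * real (K0 + n))" for n
  define M where "M n = nat \<lfloor>X n\<rfloor>" for n
  define c where "c n = \<epsilon> * 2 powr (\<kappa> * real (K0 + n))" for n
  have X1: "1 \<le> X n" for n
    unfolding X_def using t by (intro ge_one_powr_ge_zero) auto
  have M_le_X: "real (M n) \<le> X n" and M_pos: "0 < M n" and M_ge: "X n / 2 \<le> real (M n)" for n
  proof -
    have "1 \<le> \<lfloor>X n\<rfloor>" using X1[of n] by simp
    then have M: "real (M n) = of_int \<lfloor>X n\<rfloor>" "1 \<le> real (M n)" by (auto simp: M_def)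
    show "real (M n) \<le> X n" unfolding M(1) by simp
    have "0 < real (M n)" using M(2) by linarith
    then show "0 < M n" by simp
    have "X n < real (M n) + 1" unfolding M(1) by linarith
    then show "X n / 2 \<le> real (M n)" using M(2) by linarith
  qed
  have c_pos: "0 < c n" for n using \<epsilon> by (simp add: c_def)
  have M_le: "8 * M n \<le> 2 ^ (K0 + n)" for n
  proof -
    have "3 < (1 - t) * real K0" using K0 t by (simp add: field_simps)
    also have "\<dots> \<le> (1 - t) * real (K0 + n)" using t by (intro mult_left_mono) auto
    finally have "3 + t * real (K0 + n) \<le> real (K0 + n)" by (simp add: algebra_simps)
    then have "2 powr (3 + t * real (K0 + n)) \<le> 2 powr real (K0 + n)"
      by (intro powr_mono) auto
    then have "8 * X n \<le> 2 ^ (K0 + n)"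
      by (simp add: powr_add X_def powr_realpow power_add)
    then have "real (8 * M n) \<le> real (2 ^ (K0 + n))"
      using M_le_X[of n] by simp
    then show ?thesis by (simp only: of_nat_le_iff)
  qed
  have bound: "2 powr (real (K0 + n) * r j) * (D * c n * real (M n) powr (2 - recip (p j))) \<le> (1 - \<rho>) * \<rho> ^ n"
    if j: "j \<in> J" for n j
  proof -
    let ?K = "real (K0 + n)" and ?R = "recip (p j)"
    have "real (M n) powr (2 - ?R) \<le> X n powr (2 - ?R)"
      using M_le_X[of n] recip_bounds[OF J(1)[OF j]] by (intro powr_mono2) auto
    then have "2 powr (?K * r j) * (D * c n * real (M n) powr (2 - ?R))
        \<le> 2 powr (?K * r j) * (D * c n * X n powr (2 - ?R))"
      using c_pos[of n] D by (intro mult_left_mono) auto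
    also have "\<dots> = (D * \<epsilon>) * (2 powr (?K * r j) * 2 powr (\<kappa> * ?K) * 2 powr (t * ?K * (2 - ?R)))"
      by (simp only: c_def X_def powr_powr mult_ac)
    also have "\<dots> = (1 - \<rho>) * 2 powr (?K * (r j - l + \<beta> - t * ?R))"
      unfolding \<epsilon>(2) by (simp only: powr_add[symmetric]) (simp add: \<kappa>_def algebra_simps)
    also have "\<dots> \<le> (1 - \<rho>) * 2 powr (real n * (- \<delta>))"
    proof (intro mult_left_mono powr_mono)
      have "?K * (r j - l + \<beta> - t * ?R) \<le> ?K * (- \<delta>)"
        by (intro mult_left_mono J(3)[OF j]) simp
      also have "\<dots> \<le> real n * (- \<delta>)"
        using \<open>0 < \<delta>\<close> by (simp add: mult_right_mono)
      finally show "?K * (r j - l + \<beta> - t * ?R) \<le> real n * (- \<delta>)" .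
    qed (use \<rho> in auto)
    also have "2 powr (real n * (- \<delta>)) = \<rho> ^ n"
    proof -
      have "2 powr (real n * (- \<delta>)) = \<rho> powr real n"
        unfolding \<rho>_def by (simp only: powr_powr mult.commute)
      also have "\<dots> = \<rho> ^ n" using \<rho> by (intro powr_realpow)
      finally show ?thesis .
    qed
    finally show ?thesis .
  qed
  obtain j0 where j0: "j0 \<in> J" using \<open>J \<noteq> {}\<close> by blast
  \<comment> \<open>\<open>L\<^sub>1\<close> convergence follows from the bound for any one ball:
    the weight and \<open>D\<close> are at least 1, and M \<le> M^(2 - 1/p) since 1/p \<le>
    1.\<close>
  have summable: "summable (\<lambda>n. c n * real (M n))"
  proof (rule summable_comparison_test)
    show "summable (\<lambda>n. (1 - \<rho>) * \<rho> ^ n)"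
      using \<rho> by (intro summable_mult summable_geometric) auto
    have "c n * real (M n) \<le> (1 - \<rho>) * \<rho> ^ n" for n
    proof -
      have "real (M n) powr 1 \<le> real (M n) powr (2 - recip (p j0))"
        using M_pos[of n] recip_bounds[OF J(1)[OF j0]] by (intro powr_mono) auto
      then have "1 * (1 * c n * real (M n)) \<le> 2 powr (real (K0 + n) * r j0) * (D * c n * real (M n) powr (2 - recip (p j0)))"
        using c_pos[of n] D J(2)[OF j0]
        by (intro mult_mono ge_one_powr_ge_zero) (auto intro!: mult_nonneg_nonneg)
      then show ?thesis using bound[OF j0, of n] by simp
    qed
    then show "\<exists>N. \<forall>n\<ge>N. norm (c n * real (M n)) \<le> (1 - \<rho>) * \<rho> ^ n"
      using c_pos by (simp add: less_imp_le)
  qed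
  have unbounded: "\<exists>n. B < 2 powr (real (K0 + n) * l) * (c n * real (M n) powr (2 - 1 / q))" for B
  proof -
    define \<gamma> where "\<gamma> = \<beta> - t * (1 / q)"
    have "1 < 2 powr \<gamma>" using \<beta> by (simp add: \<gamma>_def)
    then obtain n where n: "4 * B / \<epsilon> < (2 powr \<gamma>) ^ n"
      using real_arch_pow by blast
    let ?K = "real (K0 + n)"
    have "B < \<epsilon> / 4 * (2 powr \<gamma>) ^ n"
      using n \<epsilon> by (simp add: field_simps)
    also have "\<dots> \<le> \<epsilon> / 4 * 2 powr (?K * \<gamma>)"
    proof (intro mult_left_mono)
      have "(2 powr \<gamma>) ^ n = 2 powr (\<gamma> * real n)"
        by (simp only: powr_realpow[symmetric] powr_powr powr_gt_zero)
      also have "\<dots> \<le> 2 powr (?K * \<gamma>)"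
        using \<beta> by (intro powr_mono) (auto simp: \<gamma>_def mult.commute intro!: mult_right_mono)
      finally show "(2 powr \<gamma>) ^ n \<le> 2 powr (?K * \<gamma>)" .
    qed (use \<epsilon> in auto)
    also have "\<dots> = 1 / 4 * (\<epsilon> * (2 powr (?K * l) * 2 powr (\<kappa> * ?K) * 2 powr (t * ?K * (2 - 1 / q))))"
      by (simp only: powr_add[symmetric]) (simp add: \<gamma>_def \<kappa>_def algebra_simps)
    also have "\<dots> = 2 powr (?K * l) * (c n * (X n powr (2 - 1 / q) / 4))"
      by (simp add: c_def X_def powr_powr)
    also have "\<dots> \<le> 2 powr (?K * l) * (c n * real (M n) powr (2 - 1 / q))"
    proof (intro mult_left_mono)
      have "1 / q \<le> 2" using \<open>2 < q\<close> by (simp add: field_simps)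
      \<comment> \<open>Rounding \<open>X n\<close> down to an integer loses at most a factor 2 in
        the base, hence at most 2^2 = 4 after taking the power.\<close>
      have "X n powr (2 - 1 / q) / 4 = X n powr (2 - 1 / q) / 2 powr 2" by simp
      also have "\<dots> \<le> X n powr (2 - 1 / q) / 2 powr (2 - 1 / q)"
        using \<open>2 < q\<close> by (intro divide_left_mono powr_mono) auto
      also have "\<dots> = (X n / 2) powr (2 - 1 / q)"
        using X1[of n] by (simp add: powr_divide)
      also have "\<dots> \<le> real (M n) powr (2 - 1 / q)"
        using M_ge[of n] X1[of n] \<open>1 / q \<le> 2\<close> by (intro powr_mono2) auto
      finally show "X n powr (2 - 1 / q) / 4 \<le> real (M n) powr (2 - 1 / q)" .
    qed (use c_pos[of n] in auto)
    finally show ?thesis by blast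
  qed
  obtain e :: 'd where True by blast
  interpret bump_series \<eta> e K0 M c
    by standard (use cutoff M_pos M_le c_pos summable in auto)
  have "series \<in> besov_ball \<eta> (\<chi> i. r j) (p j) \<theta>" if "j \<in> J" "1 \<le> \<theta>" for j \<theta>
    using series_in_besov_ball[OF J(1)[OF that(1)] that(2) less_imp_le[OF J(2)[OF that(1)]] \<rho>]
      bound[OF that(1)] by (simp add: D_def)
  moreover have "series - y \<notin> besov_space \<eta> (\<chi> i. l) (ennreal q) (ennreal \<sigma>)"
    if "y \<in> besov_space \<eta> (\<chi> i. l) (ennreal q) (ennreal \<sigma>)" for y
    using series_not_in_besov_space[OF assms(3,4) unbounded that] .
  ultimately show ?thesis by blast
qed

text \<open>Every approximating subspace lies in \<open>X\<close>, so the single element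
  \<open>f\<close> has infinite distance to each of them, whatever their dimension.\<close>

lemma kolmogorov_width_eq_infinity:
  assumes "f \<in> W" "\<And>y. y \<in> X \<Longrightarrow> f - y \<notin> X"
  shows "kolmogorov_width W X N n = \<infinity>"
proof -
  have "(SUP x\<in>W. INF y\<in>L. if x - y \<in> X then N (x - y) else \<infinity>) = \<infinity>" if "L \<subseteq> X" for L
  proof -
    have "(INF y\<in>L. if f - y \<in> X then N (f - y) else \<infinity>) = \<infinity>"
      using assms(2) that by (auto intro!: top_le INF_greatest)
    then have "\<infinity> \<le> (SUP x\<in>W. INF y\<in>L. if x - y \<in> X then N (x - y) else \<infinity>)"
      by (rule ord_eq_le_trans[OF sym SUP_upper[OF assms(1)]])
    then show ?thesis by (simp only: infinity_ennreal_def top_unique)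
  qed
  then show ?thesis
    unfolding kolmogorov_width_def by (auto intro!: top_le INF_greatest)
qed

theorem theorem6:
  fixes \<eta> :: "real \<Rightarrow> real" and s n :: nat and q \<sigma> l :: real
    and r \<alpha> :: "nat \<Rightarrow> real" and p \<theta> :: "nat \<Rightarrow> ennreal"
    and I :: "nat set" and lam :: "nat \<Rightarrow> nat \<Rightarrow> real" and i0 j0 :: nat
  assumes "cutoff \<eta>"
    and "s \<ge> 1" and "2 < q" and "2 < \<sigma>" and "l > 0"
    and "\<forall>j\<in>{1..s}. r j > 0"
    and "\<forall>j\<in>{1..s}. \<alpha> j = r j - l"
    and "\<forall>j\<in>{1..s}. 1 \<le> p j"
    and "\<forall>j\<in>{1..s}. 1 \<le> \<theta> j"
    and a1: "\<forall>i\<in>{1..s}. \<forall>j\<in>{1..s}. i < j \<longrightarrow> \<alpha> i < \<alpha> j"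
    and a2: "\<forall>i\<in>{1..s}. \<forall>j\<in>{1..s}. i < j \<longrightarrow> \<alpha> i - recip (p i) > \<alpha> j - recip (p j)"
    and b1: "\<exists>j\<in>{1..s}. p j < ennreal q"
    and b2: "\<exists>j\<in>{1..s}. p j > 2"
    and c: "\<forall>j\<in>{1..s}. p j \<notin> {2, ennreal q}"
    and d: "\<forall>i\<in>{1..s}. \<forall>j\<in>{1..s}. \<forall>i'\<in>{1..s}. \<forall>j'\<in>{1..s}.
              i > j \<longrightarrow> i' > j' \<longrightarrow> (i, j) \<noteq> (i', j') \<longrightarrow>
              (\<alpha> i - \<alpha> j) / (recip (p i) - recip (p j))
                \<noteq> (\<alpha> i' - \<alpha> j') / (recip (p i') - recip (p j'))"
    and I: "I = {j\<in>{1..s}. p j > ennreal q}" "I \<noteq> {}"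
    and lam: "\<forall>i\<in>I. \<forall>j\<in>{1..s}. p j < ennreal q \<longrightarrow>
                1 / q = (1 - lam i j) * recip (p i) + lam i j * recip (p j)"
    and ij0: "i0 \<in> I" "j0 \<in> {1..s}" "p j0 < ennreal q"
    and max: "\<forall>i\<in>I. \<forall>j\<in>{1..s}. p j < ennreal q \<longrightarrow>
                (1 - lam i j) * \<alpha> i + lam i j * \<alpha> j
                  \<le> (1 - lam i0 j0) * \<alpha> i0 + lam i0 j0 * \<alpha> j0"
    and neg: "(1 - lam i0 j0) * \<alpha> i0 + lam i0 j0 * \<alpha> j0 < 0"
  shows "kolmogorov_width
           (\<Inter>j\<in>{1..s}. besov_ball \<eta> (\<chi> i. r j) (p j) (\<theta> j))
           (besov_space \<eta> (\<chi> i::'d::finite. l) (ennreal q) (ennreal \<sigma>))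
           (besov_norm \<eta> (\<chi> i. l) (ennreal q) (ennreal \<sigma>))
           n = \<infinity>"
proof -
  let ?J = "{1..s}" and ?Q = "1 / q"
  have p_le: "p j < ennreal q \<longleftrightarrow> ?Q < recip (p j)" and p_ge: "ennreal q < p j \<longleftrightarrow> recip (p j) < ?Q"
    and p_ne: "recip (p j) \<noteq> ?Q" if "j \<in> ?J" for j
    using that \<open>2 < q\<close> \<open>\<forall>j\<in>{1..s}. 1 \<le> p j\<close> c recip_less[of q "p j"] less_recip[of "p j" q]
    by (cases "p j" "ennreal q" rule: linorder_cases; force)+
  \<comment> \<open>By (a), i < j implies 0 < \<alpha>_j - \<alpha>_i < 1/p_j - 1/p_i. Hence 1/p_j
    increases strictly with the index and determines the order of the indices.\<close>
  have order: "i < j" if "i \<in> ?J" "j \<in> ?J" "recip (p i) < recip (p j)" for i j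
    using a1 a2 that by (metis diff_strict_mono less_asym linorder_neqE_nat less_irrefl)
  have pair: "\<alpha> j * (?Q - recip (p i)) + \<alpha> i * (recip (p j) - ?Q) < 0"
    if ij: "i \<in> ?J" "j \<in> ?J" "recip (p i) < ?Q" "?Q < recip (p j)" for i j
  proof -
    have "i \<in> I" "p j < ennreal q" using ij p_le p_ge I by auto
    then have "(1 - lam i j) * \<alpha> i + lam i j * \<alpha> j < 0"
      and eq: "?Q = (1 - lam i j) * recip (p i) + lam i j * recip (p j)"
      using max neg lam ij by force+
    \<comment> \<open>Multiplying by the positive number 1/p_j - 1/p_i eliminates \<lambda>, which
      equals (1/q - 1/p_i) / (1/p_j - 1/p_i).\<close>
    then have "((1 - lam i j) * \<alpha> i + lam i j * \<alpha> j) * (recip (p j) - recip (p i)) < 0"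
      using ij by (intro mult_neg_pos) auto
    also have "((1 - lam i j) * \<alpha> i + lam i j * \<alpha> j) * (recip (p j) - recip (p i))
        = \<alpha> j * (?Q - recip (p i)) + \<alpha> i * (recip (p j) - ?Q)"
      unfolding eq by (simp add: algebra_simps)
    finally show ?thesis .
  qed
  have i0: "i0 \<in> ?J" "recip (p i0) < ?Q" and j0: "?Q < recip (p j0)"
    using ij0 I p_le p_ge by auto
  obtain t \<beta> \<delta> where t: "0 < t" "t < 1" "0 < \<delta>" "t * ?Q < \<beta>"
    "\<And>j. j \<in> ?J \<Longrightarrow> \<alpha> j + \<beta> - t * recip (p j) \<le> - \<delta>"
  proof (rule exists_exponents[of ?J ?Q "\<lambda>j. recip (p j)" \<alpha>])
    \<comment> \<open>Since i < j0, a nonnegative \<alpha>_i would make \<alpha>_j0 positive, so the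
      interpolated smoothness of the pair i, j0 could not be negative.\<close>
    show "\<alpha> i < 0" if i: "i \<in> ?J" "recip (p i) < ?Q" for i
    proof (rule ccontr)
      assume "\<not> \<alpha> i < 0"
      moreover have "\<alpha> i < \<alpha> j0"
        using order[of i j0] i j0 ij0 a1 by auto
      ultimately have "0 \<le> \<alpha> j0 * (?Q - recip (p i)) + \<alpha> i * (recip (p j0) - ?Q)"
        using i j0 by (intro add_nonneg_nonneg mult_nonneg_nonneg) auto
      then show False using pair[OF i(1) ij0(2) i(2) j0] by simp
    qed
    \<comment> \<open>The mirror argument for \<alpha> - 1/p, which decreases: as i0 < j, failure at
      j gives \<alpha> \<ge> 1/p - 1/q at i0 as well. Interpolating the two inequalities at 1/q
      makes the right-hand sides cancel and contradicts \<open>pair\<close>.\<close>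
    show "\<alpha> j < recip (p j) - ?Q" if j: "j \<in> ?J" "?Q < recip (p j)" for j
    proof (rule ccontr)
      assume "\<not> \<alpha> j < recip (p j) - ?Q"
      moreover have "\<alpha> j - recip (p j) < \<alpha> i0 - recip (p i0)"
        using order[of i0 j] i0 j a2 by auto
      ultimately have "(recip (p j) - ?Q) * (?Q - recip (p i0)) + (recip (p i0) - ?Q) * (recip (p j) - ?Q)
          \<le> \<alpha> j * (?Q - recip (p i0)) + \<alpha> i0 * (recip (p j) - ?Q)"
        using i0 j by (intro add_mono mult_right_mono) auto
      moreover have "(recip (p j) - ?Q) * (?Q - recip (p i0)) + (recip (p i0) - ?Q) * (recip (p j) - ?Q) = 0"
        by (simp add: algebra_simps)
      ultimately show False using pair[OF i0(1) j(1) i0(2) j(2)] by linarith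
    qed
  qed (use pair p_ne \<open>s \<ge> 1\<close> \<open>2 < q\<close> in auto)
  have "\<exists>f. (\<forall>j\<in>?J. \<forall>\<theta>\<ge>1. f \<in> besov_ball \<eta> (\<chi> i::'d. r j) (p j) \<theta>) \<and>
      (\<forall>y \<in> besov_space \<eta> (\<chi> i. l) (ennreal q) (ennreal \<sigma>).
        f - y \<notin> besov_space \<eta> (\<chi> i. l) (ennreal q) (ennreal \<sigma>))"
    using assms(1-9) t by (intro exists_function_outside[of _ _ _ _ t \<delta> \<beta>]) auto
  then obtain f where "\<And>j \<theta>. j \<in> ?J \<Longrightarrow> 1 \<le> \<theta> \<Longrightarrow> f \<in> besov_ball \<eta> (\<chi> i::'d. r j) (p j) \<theta>"
    and "\<And>y. y \<in> besov_space \<eta> (\<chi> i. l) (ennreal q) (ennreal \<sigma>) \<Longrightarrow>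
        f - y \<notin> besov_space \<eta> (\<chi> i. l) (ennreal q) (ennreal \<sigma>)"
    by blast
  then show ?thesis
    using assms(9) by (intro kolmogorov_width_eq_infinity[of f]) auto
qed

end
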